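(* Suppose that $X$ is a Banach space (real or complex) that contains an infinite-dimensional subspace isomorphic to a Banach lattice (for example, an infinite-dimensional subspace with an unconditional basis). Then for some $\varepsilon>0$ the unit sphere of $X$ contains a symmetrically $(1+\varepsilon)$-separated sequence.
   Context: For $\delta>0$, a sequence $(x_n)$ in a normed space is symmetrically $\delta$-separated if $\|x_n\pm x_k\|\ge\delta$ (both signs) for all $n\neq k$. "Isomorphic" means linearly homeomorphic as Banach spaces. *)

theory Defs
  imports "HOL-Analysis.Analysis" "HOL-Library.Lattice_Algebras" "HOL-Library.Lub_Glb"
begin

section \<open>Banach lattices and complex Banach spaces\<close>

text \<open>The class \<^class>\<open>lattice_ab_group_add_abs\<close> supplies the modulus
  \<open>\<bar>x\<bar> = sup x (- x)\<close>.\<close>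

class banach_lattice = banach + ordered_real_vector + lattice_ab_group_add_abs +
  assumes norm_mono_abs: "\<bar>x\<bar> \<le> \<bar>y\<bar> \<Longrightarrow> norm x \<le> norm y"

instance real :: banach_lattice
  by standard (auto simp: sup_real_def)

class complex_banach = banach +
  fixes scaleC :: "complex \<Rightarrow> 'a \<Rightarrow> 'a"  (infixr \<open>*\<^sub>C\<close> 75)
  assumes scaleC_add_right: "c *\<^sub>C (x + y) = c *\<^sub>C x + c *\<^sub>C y"
    and scaleC_add_left: "(c + d) *\<^sub>C x = c *\<^sub>C x + d *\<^sub>C x"
    and scaleC_scaleC: "c *\<^sub>C (d *\<^sub>C x) = (c * d) *\<^sub>C x"
    and scaleC_of_real: "complex_of_real r *\<^sub>C x = r *\<^sub>R x"
    and norm_scaleC: "norm (c *\<^sub>C x) = cmod c * norm x"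

instantiation complex :: complex_banach
begin
definition scaleC_complex :: "complex \<Rightarrow> complex \<Rightarrow> complex"
  where "scaleC_complex c x = c * x"
instance
  by standard (auto simp: scaleC_complex_def algebra_simps norm_mult scaleR_conv_of_real)
end

lemma vector_space_scaleC: "vector_space (scaleC :: complex \<Rightarrow> 'a::complex_banach \<Rightarrow> 'a)"
proof
  show "1 *\<^sub>C x = x" for x :: 'a
    using scaleC_of_real[of 1 x] by simp
qed (simp_all add: scaleC_add_right scaleC_add_left scaleC_scaleC)

text \<open>A complex Banach lattice is the complexification \<open>E \<oplus> \<i>E\<close> of a real Banach lattice \<open>E\<close>,
  with modulus \<open>\<bar>x + \<i>y\<bar> = sup {cos \<theta> x + sin \<theta> y | \<theta>}\<close> and norm \<open>\<parallel>z\<parallel> = \<parallel>\<bar>z\<bar>\<parallel>\<close>. The predicate below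
  says that the complex Banach space \<open>'c\<close> is that complexification, \<open>\<iota>\<close> being the inclusion
  of the real part. The supremum exists in every Banach lattice, so requiring an \<open>m\<close> is no
  restriction.\<close>

definition complexification :: "('e::banach_lattice \<Rightarrow> 'c::complex_banach) \<Rightarrow> bool"
  where "complexification \<iota> \<longleftrightarrow>
    linear \<iota> \<and>
    (\<forall>z. \<exists>!(x, y). z = \<iota> x + \<i> *\<^sub>C \<iota> y) \<and>
    (\<forall>x y. \<exists>m. isLub UNIV (range (\<lambda>\<theta>. cos \<theta> *\<^sub>R x + sin \<theta> *\<^sub>R y)) m \<and>
               norm (\<iota> x + \<i> *\<^sub>C \<iota> y) = norm m)"

lemma complexification_of_real: "complexification complex_of_real"
  unfolding complexification_def
proof (intro conjI allI)
  show "linear complex_of_real"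
    by (rule linearI) (simp_all add: scaleR_conv_of_real)
  show "\<exists>!(x, y). z = complex_of_real x + \<i> *\<^sub>C complex_of_real y" for z
    by (rule ex1I[of _ "(Re z, Im z)"]) (auto simp: scaleC_complex_def complex_eq_iff)
  fix x y :: real
  let ?r = "cmod (Complex x y)"
  have "cos \<theta> *\<^sub>R x + sin \<theta> *\<^sub>R y \<le> ?r" for \<theta>
  proof -
    have "cos \<theta> *\<^sub>R x + sin \<theta> *\<^sub>R y = Re (cis (- \<theta>) * Complex x y)"
      by simp
    also have "\<dots> \<le> cmod (cis (- \<theta>) * Complex x y)"
      by (rule complex_Re_le_cmod)
    finally show ?thesis
      by (simp add: norm_mult)
  qed
  moreover have "\<exists>\<theta>. ?r = cos \<theta> *\<^sub>R x + sin \<theta> *\<^sub>R y"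
  proof -
    let ?t = "Arg (Complex x y)"
    have "Complex x y = rcis ?r ?t"
      by (simp add: rcis_cmod_Arg)
    then have "x = ?r * cos ?t" "y = ?r * sin ?t"
      by (metis Re_rcis complex.sel(1), metis Im_rcis complex.sel(2))
    then have "cos ?t * x + sin ?t * y = ?r * ((cos ?t)\<^sup>2 + (sin ?t)\<^sup>2)"
      by (metis (no_types, opaque_lifting) distrib_left mult.left_commute power2_eq_square)
    then show ?thesis
      by (intro exI[of _ ?t]) simp
  qed
  ultimately have "isLub UNIV (range (\<lambda>\<theta>. cos \<theta> *\<^sub>R x + sin \<theta> *\<^sub>R y)) ?r"
    unfolding isLub_def leastP_def isUb_def setle_def setge_def by auto
  moreover have "norm (complex_of_real x + \<i> *\<^sub>C complex_of_real y) = norm ?r"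
    by (simp add: scaleC_complex_def cmod_def)
  ultimately show "\<exists>m. isLub UNIV (range (\<lambda>\<theta>. cos \<theta> *\<^sub>R x + sin \<theta> *\<^sub>R y)) m \<and>
      norm (complex_of_real x + \<i> *\<^sub>C complex_of_real y) = norm m"
    by blast
qed

section \<open>Subspaces, isomorphisms and bases\<close>

text \<open>The scalar multiplication is a parameter, to be instantiated with \<^const>\<open>scaleR\<close> or
  \<^const>\<open>scaleC\<close>.\<close>

definition infinite_dim_subspace ::
    "('k::field \<Rightarrow> 'a \<Rightarrow> 'a::real_normed_vector) \<Rightarrow> 'a set \<Rightarrow> bool"
  where "infinite_dim_subspace s Y \<longleftrightarrow>
    module.subspace s Y \<and> (\<nexists>B. finite B \<and> Y \<subseteq> module.span s B)"

definition isomorphism_onto ::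
    "('k::field \<Rightarrow> 'b \<Rightarrow> 'b::real_normed_vector) \<Rightarrow> ('k \<Rightarrow> 'a \<Rightarrow> 'a::real_normed_vector)
      \<Rightarrow> ('b \<Rightarrow> 'a) \<Rightarrow> 'a set \<Rightarrow> bool"
  where "isomorphism_onto s1 s2 T Y \<longleftrightarrow>
    Vector_Spaces.linear s1 s2 T \<and> (\<exists>S. homeomorphism UNIV Y T S)"

text \<open>The last clause says that the expansions converge unconditionally.\<close>

definition unconditional_basis ::
    "('k::field \<Rightarrow> 'a \<Rightarrow> 'a::real_normed_vector) \<Rightarrow> (nat \<Rightarrow> 'a) \<Rightarrow> 'a set \<Rightarrow> bool"
  where "unconditional_basis s e Y \<longleftrightarrow>
    range e \<subseteq> Y \<and>
    (\<forall>y\<in>Y. \<exists>!a. (\<lambda>n. s (a n) (e n)) sums y) \<and>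
    (\<forall>y\<in>Y. \<forall>a. (\<lambda>n. s (a n) (e n)) sums y \<longrightarrow> ((\<lambda>n. s (a n) (e n)) has_sum y) UNIV)"

section \<open>Symmetrically separated sequences\<close>

definition symmetrically_separated :: "real \<Rightarrow> (nat \<Rightarrow> 'a::real_normed_vector) \<Rightarrow> bool"
  where "symmetrically_separated \<delta> x \<longleftrightarrow>
    (\<forall>n k. n \<noteq> k \<longrightarrow> \<delta> \<le> norm (x n + x k) \<and> \<delta> \<le> norm (x n - x k))"

end

theory Submission
  imports Defs
begin

text \<open>A Banach lattice of infinite dimension contains a disjoint sequence and an unconditional basis
  has bounded partial sums over sets of indices, so it is enough to treat finite combinations of an
  unconditional sequence, with real coefficients. Let \<open>E\<close> be a filter on unit vectors that move off to
  infinity. If no \<open>(1 + \<epsilon>)\<close>-separated sequence can be chosen along \<open>E\<close>, then the sums \<open>u \<plusminus> v\<close>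
  with \<open>u\<close> and \<open>v\<close> taken successively along \<open>E\<close> and \<open>\<parallel>u \<plusminus> v\<parallel> \<le> 1 + \<epsilon>\<close> generate, after
  normalisation, a new filter of the same kind, whose members almost dominate coordinatewise the members
  of \<open>E\<close>. By Zorn's lemma there is an \<open>E\<close> that is maximal for this domination, so the sums in turn
  are almost dominated by members of \<open>E\<close>. Iterating with \<open>\<epsilon>\<close> tending to \<open>0\<close> gives disjoint unit vectors
  with bounded partial sums, that is, a copy of \<open>c\<^sub>0\<close>, and there James' distortion argument
  applies.\<close>

text \<open>The constant 1 + \<epsilon> is not an isomorphism invariant, so the space cannot be
  renormed to make the unconditional constant equal to 1. That constant \<open>C\<close> is carried
  along to the end, where James' argument repairs the distortion. The sign that makes u + s v short
  depends on the pair and cannot be controlled. This is harmless: for disjoint supports u + v and u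
  - v have the same absolute coordinates, so conditions expressed by solid sets do not see the sign.
  Domination is compared only up to factors t > 1 because a short sum has norm at most t, not at
  most 1. Filters stand in for subsequences: a chain of them has a plain infimum, which is what
  Zorn's lemma asks for, and a single filter governs all later choices at once. The factors lost at
  the successive extensions are prescribed beforehand with product below 2, which leads to the final
  bound 2 * C.\<close>

definition sphere_separates :: "'a::real_normed_vector itself \<Rightarrow> bool"
  where "sphere_separates _ \<longleftrightarrow>
    (\<exists>\<epsilon>>0. \<exists>x :: nat \<Rightarrow> 'a. range x \<subseteq> sphere 0 1 \<and> symmetrically_separated (1 + \<epsilon>) x)"

section \<open>From the ball to the sphere\<close>

text \<open>Since t x + y = t (x + y) - (t - 1) y, the norm is at least t \<delta> - (t - 1), and
  this is at least \<delta> because \<delta> \<ge> 1.\<close>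

lemma norm_scale_add_ge:
  fixes x y :: "'a::real_normed_vector"
  assumes "norm y \<le> 1" "1 \<le> \<delta>" "\<delta> \<le> norm (x + y)" "1 \<le> t"
  shows "\<delta> \<le> norm (t *\<^sub>R x + y)"
proof -
  have "t * \<delta> \<le> norm (t *\<^sub>R (x + y))"
    using assms by simp
  also have "t *\<^sub>R (x + y) = (t *\<^sub>R x + y) + (t - 1) *\<^sub>R y"
    by (simp add: algebra_simps)
  also have "norm \<dots> \<le> norm (t *\<^sub>R x + y) + (t - 1) * norm y"
    using norm_triangle_ineq[of "t *\<^sub>R x + y" "(t - 1) *\<^sub>R y"] assms by simp
  also have "\<dots> \<le> norm (t *\<^sub>R x + y) + (t - 1) * 1"
    using assms by (intro add_mono mult_left_mono) auto
  finally have "t * \<delta> - (t - 1) \<le> norm (t *\<^sub>R x + y)"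
    by simp
  moreover have "0 \<le> (t - 1) * (\<delta> - 1)"
    using assms by simp
  ultimately show ?thesis
    by (simp add: algebra_simps)
qed

text \<open>The two vectors are pushed out to the sphere one after the other. Strictness of 1 <
  \<delta> also makes them nonzero.\<close>

lemma norm_sgn_add_ge:
  fixes x y :: "'a::real_normed_vector"
  assumes "norm x \<le> 1" "norm y \<le> 1" "1 < \<delta>" "\<delta> \<le> norm (x + y)"
  shows "\<delta> \<le> norm (sgn x + sgn y)"
proof -
  have "x \<noteq> 0" "y \<noteq> 0"
    using assms by auto
  then have t: "1 \<le> inverse (norm x)" "1 \<le> inverse (norm y)"
    using assms by (auto simp: one_le_inverse_iff)
  have "\<delta> \<le> norm (sgn x + y)"
    unfolding sgn_div_norm using assms t by (intro norm_scale_add_ge) auto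
  then have "\<delta> \<le> norm (y + sgn x)"
    by (simp add: add.commute)
  then have "\<delta> \<le> norm (sgn y + sgn x)"
    unfolding sgn_div_norm[of y] using assms t \<open>x \<noteq> 0\<close>
    by (intro norm_scale_add_ge) (auto simp: norm_sgn)
  then show ?thesis
    by (simp add: add.commute)
qed

text \<open>Only the ratio of separation to radius matters, so constructions may produce vectors of
  a ball instead of unit vectors.\<close>

lemma sphere_separates_if_ball:
  fixes w :: "nat \<Rightarrow> 'a::real_normed_vector"
  assumes "0 < \<kappa>" "\<And>n. norm (w n) \<le> \<kappa>" "1 < \<delta>" "symmetrically_separated (\<delta> * \<kappa>) w"
  shows "sphere_separates TYPE('a)"
proof -
  let ?v = "\<lambda>n. inverse \<kappa> *\<^sub>R w n"
  let ?x = "\<lambda>n. sgn (?v n)"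
  have v: "norm (?v n) \<le> 1" for n
    using assms(1) assms(2)[of n] by (simp add: field_simps)
  have sep: "\<delta> \<le> norm (?v n + ?v k)" "\<delta> \<le> norm (?v n - ?v k)" if "n \<noteq> k" for n k
  proof -
    have "\<delta> * \<kappa> \<le> norm (w n + w k)" "\<delta> * \<kappa> \<le> norm (w n - w k)"
      using assms(4) that unfolding symmetrically_separated_def by auto
    moreover have "norm (?v n + ?v k) = norm (w n + w k) / \<kappa>" "norm (?v n - ?v k) = norm (w n - w k) / \<kappa>"
      unfolding scaleR_add_right[symmetric] scaleR_diff_right[symmetric] norm_scaleR
      using assms(1) by (simp_all add: field_simps)
    ultimately show "\<delta> \<le> norm (?v n + ?v k)" "\<delta> \<le> norm (?v n - ?v k)"
      using assms(1) by (simp_all add: pos_le_divide_eq)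
  qed
  have "symmetrically_separated \<delta> ?x"
    unfolding symmetrically_separated_def
  proof (intro allI impI conjI)
    fix n k :: nat
    assume "n \<noteq> k"
    note s = sep[OF this]
    show "\<delta> \<le> norm (?x n + ?x k)"
      by (rule norm_sgn_add_ge[OF v v assms(3) s(1)])
    have "norm (- ?v k) \<le> 1" "\<delta> \<le> norm (?v n + - ?v k)"
      using v[of k] s(2) by simp_all
    then show "\<delta> \<le> norm (?x n - ?x k)"
      using norm_sgn_add_ge[OF v[of n] _ assms(3), of "- ?v k"]
      by (simp only: sgn_minus) simp
  qed
  moreover have "?v n \<noteq> 0" for n
    using sep[of n "Suc n"] v[of "Suc n"] assms(3) by auto
  then have "range ?x \<subseteq> sphere 0 1"
    by (auto simp: norm_sgn)
  ultimately show ?thesis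
    unfolding sphere_separates_def using assms(3) by (intro exI[of _ "\<delta> - 1"]) auto
qed

section \<open>Non-distortability of \<open>c\<^sub>0\<close>\<close>

text \<open>The model is the symmetrically 2-separated sequence e_0 + ... + e_n - e_(n+1) in the
  sphere of c_0. With errors of one tenth the ratio of separation to radius is still 14/11.\<close>

lemma sphere_separates_if_almost_isometric_c0:
  fixes y :: "nat \<Rightarrow> 'a::real_normed_vector"
  assumes "0 < \<kappa>" and lower: "\<And>k. 9/10 * \<kappa> \<le> norm (y k)"
    and upper: "\<And>n \<alpha>. (\<And>k. \<bar>\<alpha> k\<bar> \<le> 1) \<Longrightarrow> norm (\<Sum>k<n. \<alpha> k *\<^sub>R y k) \<le> 11/10 * \<kappa>"
  shows "sphere_separates TYPE('a)"
proof -
  define \<alpha> where "\<alpha> n k = (if k \<le> n then 1 else if k = Suc n then - 1 else 0 :: real)" for n k :: nat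
  define w where "w n = (\<Sum>k<n + 2. \<alpha> n k *\<^sub>R y k)" for n
  have w_eq: "w n = (\<Sum>k<m. \<alpha> n k *\<^sub>R y k)" if "n + 2 \<le> m" for n m
    unfolding w_def by (rule sum.mono_neutral_left) (use that in \<open>auto simp: \<alpha>_def\<close>)
  have large: "7/5 * \<kappa> \<le> norm (\<Sum>k<m. \<gamma> k *\<^sub>R y k)"
    if "\<And>k. \<bar>\<gamma> k\<bar> \<le> 2" "\<gamma> j = 2" "j < m" for \<gamma> j m
  proof -
    let ?z = "\<Sum>k<m. \<gamma> k *\<^sub>R y k"
    \<comment> \<open>A reflection replaces a lower estimate for general combinations: 4 y j is ?z
      plus twice a combination with coefficients in [-1, 1], so the norm of ?z is at least 4 * 9/10
      - 2 * 11/10 = 7/5 times \<kappa>.\<close>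
    define \<beta> where "\<beta> k = (if k = j then 2 else 0) - \<gamma> k / 2" for k
    have "(\<Sum>k<m. \<beta> k *\<^sub>R y k) = (\<Sum>k<m. (if k = j then 2 *\<^sub>R y k else 0)) - (\<Sum>k<m. (1/2) *\<^sub>R \<gamma> k *\<^sub>R y k)"
      unfolding sum_subtractf[symmetric]
      by (rule sum.cong) (auto simp: \<beta>_def algebra_simps)
    also have "\<dots> = 2 *\<^sub>R y j - (1/2) *\<^sub>R ?z"
      using that(3) by (simp add: scaleR_sum_right)
    finally have "4 *\<^sub>R y j = ?z + 2 *\<^sub>R (\<Sum>k<m. \<beta> k *\<^sub>R y k)"
      by (simp add: scaleR_diff_right)
    then have "4 * norm (y j) \<le> norm ?z + 2 * norm (\<Sum>k<m. \<beta> k *\<^sub>R y k)"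
      using norm_triangle_ineq[of ?z "2 *\<^sub>R (\<Sum>k<m. \<beta> k *\<^sub>R y k)"]
      by (metis norm_scaleR abs_numeral)
    moreover have "\<bar>\<beta> k\<bar> \<le> 1" for k
      using that(1)[of k] that(2) by (auto simp: \<beta>_def)
    then have "norm (\<Sum>k<m. \<beta> k *\<^sub>R y k) \<le> 11/10 * \<kappa>"
      by (rule upper)
    ultimately show ?thesis
      using lower[of j] by simp
  qed
  have lt: "7/5 * \<kappa> \<le> norm (w n + w k) \<and> 7/5 * \<kappa> \<le> norm (w n - w k)" if "k < n" for n k
  proof -
    have eq: "w n + w k = (\<Sum>i<n + 2. (\<alpha> n i + \<alpha> k i) *\<^sub>R y i)"
        "w n - w k = (\<Sum>i<n + 2. (\<alpha> n i - \<alpha> k i) *\<^sub>R y i)"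
      using that by (simp_all add: w_eq[of _ "n + 2"] scaleR_add_left scaleR_diff_left
          sum.distrib sum_subtractf)
    \<comment> \<open>The sum has coefficient 1 + 1 at 0. The difference has 1 - (- 1) at
      \<open>Suc k\<close>, the place of the minus sign in \<open>w k\<close>, because k <
      n.\<close>
    show ?thesis
      unfolding eq using that
      by (intro conjI large[where j = 0] large[where j = "Suc k"]) (auto simp: \<alpha>_def)
  qed
  show ?thesis
  proof (rule sphere_separates_if_ball)
    show "norm (w n) \<le> 11/10 * \<kappa>" for n
      unfolding w_def by (rule upper) (auto simp: \<alpha>_def)
    show "symmetrically_separated (14/11 * (11/10 * \<kappa>)) w"
      unfolding symmetrically_separated_def
    proof (intro allI impI)
      fix n k :: nat
      assume "n \<noteq> k"
      then consider "k < n" | "n < k"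
        by linarith
      then show "14/11 * (11/10 * \<kappa>) \<le> norm (w n + w k) \<and> 14/11 * (11/10 * \<kappa>) \<le> norm (w n - w k)"
        by cases (use lt[of k n] lt[of n k] in \<open>auto simp: add.commute norm_minus_commute\<close>)
    qed
  qed (use assms(1) in auto)
qed

text \<open>James' argument: beyond some index the suprema \<open>f m\<close> are almost constant, so blocks that almost
  attain them span an almost isometric copy of \<open>c\<^sub>0\<close>.\<close>

lemma sphere_separates_if_c0:
  fixes x :: "nat \<Rightarrow> 'a::real_normed_vector"
  assumes unit: "\<And>k. norm (x k) = 1"
    and bound: "\<And>n \<alpha>. (\<And>k. \<bar>\<alpha> k\<bar> \<le> 1) \<Longrightarrow> norm (\<Sum>k<n. \<alpha> k *\<^sub>R x k) \<le> M"
  shows "sphere_separates TYPE('a)"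
proof -
  define U where "U m n = {v. \<exists>\<alpha>. (\<forall>k. \<bar>\<alpha> k\<bar> \<le> 1) \<and> v = (\<Sum>k=m..<n. \<alpha> k *\<^sub>R x k)}" for m n
  have U_I: "(\<Sum>k=m..<n. \<alpha> k *\<^sub>R x k) \<in> U m n" if "\<And>k. \<bar>\<alpha> k\<bar> \<le> 1" for m n \<alpha>
    using that by (auto simp: U_def)
  have U_sub: "U m n \<subseteq> U m' n'" if "m' \<le> m" "n \<le> n'" for m n m' n'
  proof
    fix v assume "v \<in> U m n"
    then obtain \<alpha> where \<alpha>: "\<And>k. \<bar>\<alpha> k\<bar> \<le> 1" "v = (\<Sum>k=m..<n. \<alpha> k *\<^sub>R x k)"
      by (auto simp: U_def)
    have "v = (\<Sum>k=m'..<n'. (if k \<in> {m..<n} then \<alpha> k else 0) *\<^sub>R x k)"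
      unfolding \<alpha>(2) by (rule sum.mono_neutral_cong_left) (use that in auto)
    then show "v \<in> U m' n'"
      using \<alpha>(1) U_I[of "\<lambda>k. if k \<in> {m..<n} then \<alpha> k else 0" m' n'] by simp
  qed
  have U_add: "v + c *\<^sub>R w \<in> U m p" if "v \<in> U m n" "w \<in> U n p" "\<bar>c\<bar> \<le> 1" "m \<le> n" "n \<le> p"
    for v w c m n p
  proof -
    from that(1) obtain \<alpha> where \<alpha>: "\<And>k. \<bar>\<alpha> k\<bar> \<le> 1" "v = (\<Sum>k=m..<n. \<alpha> k *\<^sub>R x k)"
      by (auto simp: U_def)
    from that(2) obtain \<beta> where \<beta>: "\<And>k. \<bar>\<beta> k\<bar> \<le> 1" "w = (\<Sum>k=n..<p. \<beta> k *\<^sub>R x k)"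
      by (auto simp: U_def)
    note * = \<alpha> \<beta>
    let ?\<gamma> = "\<lambda>k. if k < n then \<alpha> k else c * \<beta> k"
    have "(\<Sum>k=m..<p. ?\<gamma> k *\<^sub>R x k) = (\<Sum>k=m..<n. ?\<gamma> k *\<^sub>R x k) + (\<Sum>k=n..<p. ?\<gamma> k *\<^sub>R x k)"
      by (rule sum.atLeastLessThan_concat[symmetric]) (use that in auto)
    also have "(\<Sum>k=m..<n. ?\<gamma> k *\<^sub>R x k) = v"
      unfolding * by (rule sum.cong) auto
    also have "(\<Sum>k=n..<p. ?\<gamma> k *\<^sub>R x k) = c *\<^sub>R w"
      unfolding * scaleR_sum_right by (rule sum.cong) auto
    finally have "v + c *\<^sub>R w = (\<Sum>k=m..<p. ?\<gamma> k *\<^sub>R x k)" ..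
    moreover have "\<bar>?\<gamma> k\<bar> \<le> 1" for k
      using \<alpha>(1)[of k] \<beta>(1)[of k] that(3) by (auto simp: abs_mult intro!: mult_le_one)
    ultimately show ?thesis
      using U_I[of ?\<gamma> m p] by simp
  qed
  have U_M: "norm v \<le> M" if "v \<in> U m n" for v m n
  proof -
    have "v \<in> U 0 n"
      using U_sub[of 0 m n n] that by auto
    then show ?thesis
      using bound by (auto simp: U_def atLeast0LessThan)
  qed
  define A where "A m = (\<Union>n. norm ` U m n)" for m
  define f where "f m = Sup (A m)" for m
  have bdd: "bdd_above (A m)" for m
    using U_M by (auto simp: A_def intro!: bdd_aboveI[of _ M])
  have one_in: "1 \<in> A m" for m
  proof -
    have "x m \<in> U m (Suc m)"
      using U_I[of "\<lambda>_. 1" m "Suc m"] by simp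
    then show ?thesis
      using unit[of m] unfolding A_def by (metis UNIV_I UN_I image_eqI)
  qed
  have f_ge1: "1 \<le> f m" for m
    unfolding f_def by (rule cSup_upper[OF one_in bdd])
  have f_upper: "norm v \<le> f m" if "v \<in> U m n" for v m n
    unfolding f_def by (rule cSup_upper[OF _ bdd]) (use that in \<open>auto simp: A_def\<close>)
  define \<kappa> where "\<kappa> = Inf (range f)"
  have bddf: "bdd_below (range f)"
    using f_ge1 by (auto intro!: bdd_belowI[of _ 1])
  have \<kappa>: "1 \<le> \<kappa>" "\<kappa> \<le> f m" for m
    unfolding \<kappa>_def using f_ge1 bddf by (auto intro!: cInf_greatest cInf_lower)
  \<comment> \<open>All blocks below start at or after this \<open>m\<close>, so their combinations
    with coefficients in [-1, 1] lie in some \<open>U m n\<close> and have norm at most f m < 11/10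
    \<kappa>.\<close>
  obtain m where m: "f m < 11/10 * \<kappa>"
    using cInf_lessD[of "range f" "11/10 * \<kappa>"] \<kappa>(1) unfolding \<kappa>_def[symmetric] by auto
  have ex: "\<exists>n\<ge>p. \<exists>v\<in>U p n. 9/10 * \<kappa> \<le> norm v" for p
  proof -
    have "9/10 * \<kappa> < Sup (A p)"
      using \<kappa>(1) \<kappa>(2)[of p] unfolding f_def by linarith
    then obtain a where "a \<in> A p" "9/10 * \<kappa> < a"
      using less_cSupD[of "A p"] one_in[of p] by blast
    then obtain n v where "v \<in> U p n" "9/10 * \<kappa> < norm v"
      by (auto simp: A_def)
    then show ?thesis
      using U_sub[of p p n "max p n"] by (intro exI[of _ "max p n"]) (auto intro!: less_imp_le)
  qed
  obtain g z where gz: "\<And>p. p \<le> g p" "\<And>p. z p \<in> U p (g p)" "\<And>p. 9/10 * \<kappa> \<le> norm (z p)"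
    using ex by metis
  define p where "p k = (g ^^ k) m" for k
  have p: "p (Suc k) = g (p k)" "p k \<le> p (Suc k)" for k
    using gz(1) by (simp_all add: p_def)
  have p0: "m \<le> p k" for k
    by (induction k) (use p(2) in \<open>auto simp: p_def intro: order_trans\<close>)
  show ?thesis
  proof (rule sphere_separates_if_almost_isometric_c0)
    show "9/10 * \<kappa> \<le> norm (z (p k))" for k
      by (rule gz(3))
    fix n and \<alpha> :: "nat \<Rightarrow> real"
    assume \<alpha>: "\<And>k. \<bar>\<alpha> k\<bar> \<le> 1"
    have "(\<Sum>k<n. \<alpha> k *\<^sub>R z (p k)) \<in> U m (p n)"
    proof (induction n)
      case 0
      then show ?case
        using U_I[of "\<lambda>_. 0" m "p 0"] by simp
    next
      case (Suc n)
      show ?case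
        unfolding sum.lessThan_Suc
        by (rule U_add[OF Suc _ \<alpha> p0 p(2)]) (use gz(2)[of "p n"] p(1) in simp)
    qed
    then show "norm (\<Sum>k<n. \<alpha> k *\<^sub>R z (p k)) \<le> 11/10 * \<kappa>"
      using f_upper[of _ m] m by fastforce
  qed (use \<kappa>(1) in simp)
qed

section \<open>Sequences selected by filters\<close>

text \<open>Only finitely many earlier terms constrain the next one, so any proper filter will do.
  The invariant admits only terms u for which R u v holds eventually, which leaves room for all
  later terms.\<close>

lemma filter_selects_sequence:
  assumes "E \<noteq> bot" "\<forall>\<^sub>F u in E. S u" "\<forall>\<^sub>F u in E. \<forall>\<^sub>F v in E. R u v"
  shows "\<exists>x :: nat \<Rightarrow> 'a. (\<forall>n. S (x n)) \<and> (\<forall>n. \<forall>k<n. R (x k) (x n))"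
proof -
  define Q where "Q f n u \<longleftrightarrow> S u \<and> (\<forall>\<^sub>F v in E. R u v) \<and> (\<forall>k<n. R (f k) u)"
    for f :: "nat \<Rightarrow> 'a" and n :: nat and u
  have "\<exists>x. \<forall>n. Q x n (x n)"
  proof (rule dependent_wellorder_choice)
    fix n :: nat and f :: "nat \<Rightarrow> 'a"
    assume "\<And>k. k < n \<Longrightarrow> Q f k (f k)"
    then have "\<forall>k\<in>{..<n}. \<forall>\<^sub>F v in E. R (f k) v"
      by (auto simp: Q_def)
    then have "\<forall>\<^sub>F v in E. \<forall>k\<in>{..<n}. R (f k) v"
      by (intro eventually_ball_finite) auto
    with assms(2,3) have "\<forall>\<^sub>F v in E. Q f n v"
      by eventually_elim (auto simp: Q_def)
    then show "\<exists>u. Q f n u"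
      using assms(1) eventually_happens by blast
  qed (auto simp: Q_def)
  then show ?thesis
    by (auto simp: Q_def)
qed

section \<open>The dichotomy between separated sequences and copies of \<open>c\<^sub>0\<close>\<close>

text \<open>Intended reading: V is the span of an unconditional sequence and c i its i-th coordinate
  functional. Supports are finite, so no convergence enters, and \<open>norm_le\<close> expresses
  unconditionality with constant C.\<close>

locale solid_coordinates =
  fixes V :: "'a::real_normed_vector set" and c :: "nat \<Rightarrow> 'a \<Rightarrow> real" and C :: real
  assumes subspace: "subspace V"
    and linear: "linear (c i)"
    and finite_support: "v \<in> V \<Longrightarrow> finite {i. c i v \<noteq> 0}"
    and norm_le: "u \<in> V \<Longrightarrow> v \<in> V \<Longrightarrow> (\<And>i. \<bar>c i u\<bar> \<le> \<bar>c i v\<bar>) \<Longrightarrow> norm u \<le> C * norm v"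
    and ex_far: "\<exists>v\<in>V. v \<noteq> 0 \<and> (\<forall>i<n. c i v = 0)"
begin

section \<open>Coordinatewise domination and disjoint supports\<close>

lemmas c_simps = linear_add[OF linear] linear_diff[OF linear] linear_scale[OF linear]

lemma c_sgn: "c i (sgn v) = c i v / norm v"
  by (simp add: sgn_div_norm c_simps divide_inverse mult.commute)

definition below :: "real \<Rightarrow> 'a \<Rightarrow> 'a \<Rightarrow> bool"
  where "below t u v \<longleftrightarrow> (\<forall>i. \<bar>c i u\<bar> \<le> t * \<bar>c i v\<bar>)"

definition disjoint_support :: "'a \<Rightarrow> 'a \<Rightarrow> bool"
  where "disjoint_support u v \<longleftrightarrow> (\<forall>i. c i u = 0 \<or> c i v = 0)"

lemma below_mono:
  assumes "below t u v" "t \<le> t'"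
  shows "below t' u v"
  unfolding below_def
proof
  fix i
  have "\<bar>c i u\<bar> \<le> t * \<bar>c i v\<bar>"
    using assms by (auto simp: below_def)
  also have "\<dots> \<le> t' * \<bar>c i v\<bar>"
    using assms by (intro mult_right_mono) auto
  finally show "\<bar>c i u\<bar> \<le> t' * \<bar>c i v\<bar>" .
qed

lemma below_trans:
  assumes "below s u v" "below t v w" "0 \<le> s"
  shows "below (s * t) u w"
  unfolding below_def
proof
  fix i
  have "\<bar>c i u\<bar> \<le> s * \<bar>c i v\<bar>"
    using assms by (auto simp: below_def)
  also have "\<dots> \<le> s * (t * \<bar>c i w\<bar>)"
    using assms by (intro mult_left_mono) (auto simp: below_def)
  finally show "\<bar>c i u\<bar> \<le> s * t * \<bar>c i w\<bar>"
    by simp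
qed

lemma abs_c_add_disjoint:
  assumes "disjoint_support u v" "s \<in> {1, - 1}"
  shows "\<bar>c i (u + s *\<^sub>R v)\<bar> = \<bar>c i u\<bar> + \<bar>c i v\<bar>"
  using assms by (auto simp: disjoint_support_def c_simps dest: spec[of _ i])

section \<open>Unit vectors that move off to infinity\<close>

definition far_filter :: "'a filter"
  where "far_filter = (INF n. principal {v \<in> V. norm v = 1 \<and> (\<forall>i<n. c i v = 0)})"

lemma eventually_far_filter:
  "eventually P far_filter \<longleftrightarrow> (\<exists>n. \<forall>v\<in>V. norm v = 1 \<and> (\<forall>i<n. c i v = 0) \<longrightarrow> P v)"
proof -
  have "eventually P far_filter \<longleftrightarrow>
      (\<exists>n\<in>UNIV. eventually P (principal {v \<in> V. norm v = 1 \<and> (\<forall>i<n. c i v = 0)}))"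
    unfolding far_filter_def
  proof (rule eventually_INF_base)
    show "\<exists>x\<in>UNIV. principal {v \<in> V. norm v = 1 \<and> (\<forall>i<x. c i v = 0)}
        \<le> inf (principal {v \<in> V. norm v = 1 \<and> (\<forall>i<a. c i v = 0)})
            (principal {v \<in> V. norm v = 1 \<and> (\<forall>i<b. c i v = 0)})" for a b :: nat
      by (intro bexI[of _ "max a b"]) auto
  qed simp
  then show ?thesis
    unfolding eventually_principal by blast
qed

lemma far_filter_neq_bot: "far_filter \<noteq> bot"
proof
  assume "far_filter = bot"
  then obtain n where n: "\<And>v. v \<in> V \<Longrightarrow> norm v = 1 \<Longrightarrow> \<forall>i<n. c i v = 0 \<Longrightarrow> False"
    using eventually_far_filter[of "\<lambda>_. False"] by (metis eventually_bot)
  obtain v where v: "v \<in> V" "v \<noteq> 0" "\<forall>i<n. c i v = 0"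
    using ex_far by blast
  then show False
    using n[of "sgn v"] subspace
    by (auto simp: c_sgn norm_sgn) (simp add: sgn_div_norm subspace_scale)
qed

lemma eventually_unit: "\<forall>\<^sub>F v in far_filter. v \<in> V \<and> norm v = 1"
  by (auto simp: eventually_far_filter)

lemma le_far_filter_iff:
  "E \<le> far_filter \<longleftrightarrow> (\<forall>\<^sub>F v in E. v \<in> V \<and> norm v = 1) \<and> (\<forall>i. \<forall>\<^sub>F v in E. c i v = 0)"
proof (intro iffI conjI allI)
  assume E: "E \<le> far_filter"
  show "\<forall>\<^sub>F v in E. v \<in> V \<and> norm v = 1"
    using filter_leD[OF E eventually_unit] .
  show "\<forall>\<^sub>F v in E. c i v = 0" for i
    by (rule filter_leD[OF E]) (auto simp: eventually_far_filter intro!: exI[of _ "Suc i"])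
next
  assume *: "(\<forall>\<^sub>F v in E. v \<in> V \<and> norm v = 1) \<and> (\<forall>i. \<forall>\<^sub>F v in E. c i v = 0)"
  show "E \<le> far_filter"
  proof (rule filter_leI)
    fix P assume "eventually P far_filter"
    then obtain n where n: "\<And>v. v \<in> V \<Longrightarrow> norm v = 1 \<Longrightarrow> \<forall>i<n. c i v = 0 \<Longrightarrow> P v"
      by (auto simp: eventually_far_filter)
    have "\<forall>\<^sub>F v in E. \<forall>i\<in>{..<n}. c i v = 0"
      using * by (intro eventually_ball_finite) auto
    moreover have "\<forall>\<^sub>F v in E. v \<in> V \<and> norm v = 1"
      using * by blast
    ultimately show "eventually P E"
      by eventually_elim (use n in auto)
  qed
qed

text \<open>The support of u is finite, and each of its coordinates eventually vanishes along
  E.\<close>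

lemma eventually_disjoint_support:
  assumes "E \<le> far_filter" "u \<in> V"
  shows "\<forall>\<^sub>F v in E. disjoint_support u v"
proof -
  have "\<forall>\<^sub>F v in E. \<forall>i\<in>{i. c i u \<noteq> 0}. c i v = 0"
    using assms finite_support[of u] by (intro eventually_ball_finite) (auto simp: le_far_filter_iff)
  then show ?thesis
    by eventually_elim (auto simp: disjoint_support_def)
qed

section \<open>Almost domination as a closure operator on filters\<close>

definition up :: "'a filter \<Rightarrow> 'a filter"
  where "up F = Abs_filter (\<lambda>P. \<exists>t>1. \<forall>\<^sub>F u in F. \<forall>v. below t u v \<longrightarrow> P v)"

text \<open>The filter is generated by the sets of all v that dominate, within a factor t > 1, some
  member of a given set of F. Two such conditions combine because both factors may be lowered to
  their minimum.\<close>

lemma eventually_up: "eventually P (up F) \<longleftrightarrow> (\<exists>t>1. \<forall>\<^sub>F u in F. \<forall>v. below t u v \<longrightarrow> P v)"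
  unfolding up_def
proof (rule eventually_Abs_filter, rule is_filter.intro)
  show "\<exists>t>1. \<forall>\<^sub>F u in F. \<forall>v. below t u v \<longrightarrow> True"
    by (intro exI[of _ 2]) auto
  fix P Q
  assume "\<exists>t>1. \<forall>\<^sub>F u in F. \<forall>v. below t u v \<longrightarrow> P v" "\<exists>t>1. \<forall>\<^sub>F u in F. \<forall>v. below t u v \<longrightarrow> Q v"
  then obtain s t where st: "1 < s" "1 < t" and ev: "\<forall>\<^sub>F u in F. \<forall>v. below s u v \<longrightarrow> P v"
      "\<forall>\<^sub>F u in F. \<forall>v. below t u v \<longrightarrow> Q v"
    by blast
  from ev have "\<forall>\<^sub>F u in F. \<forall>v. below (min s t) u v \<longrightarrow> P v \<and> Q v"
    by eventually_elim (meson below_mono min.cobounded1 min.cobounded2)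
  then show "\<exists>t>1. \<forall>\<^sub>F u in F. \<forall>v. below t u v \<longrightarrow> P v \<and> Q v"
    using st by (intro exI[of _ "min s t"]) auto
next
  fix P Q :: "'a \<Rightarrow> bool"
  assume "\<forall>x. P x \<longrightarrow> Q x" "\<exists>t>1. \<forall>\<^sub>F u in F. \<forall>v. below t u v \<longrightarrow> P v"
  then show "\<exists>t>1. \<forall>\<^sub>F u in F. \<forall>v. below t u v \<longrightarrow> Q v"
    by (auto elim!: eventually_mono)
qed

lemma le_up: "F \<le> up F"
proof (rule filter_leI)
  fix P assume "eventually P (up F)"
  then obtain t where t: "1 < t" "\<forall>\<^sub>F u in F. \<forall>v. below t u v \<longrightarrow> P v"
    by (auto simp: eventually_up)
  have "below t u u" for u
    using t(1) by (auto simp: below_def mult_le_cancel_right1)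
  with t(2) show "eventually P F"
    by (auto elim!: eventually_mono)
qed

lemma up_mono: "F \<le> G \<Longrightarrow> up F \<le> up G"
  by (auto simp: le_filter_def eventually_up)

text \<open>A factor t splits as sqrt t * sqrt t. This is why the factor ranges over all t > 1
  instead of being fixed.\<close>

lemma up_up: "up (up F) \<le> up F"
proof (rule filter_leI)
  fix P assume "eventually P (up F)"
  then obtain t where t: "1 < t" "\<forall>\<^sub>F u in F. \<forall>v. below t u v \<longrightarrow> P v"
    by (auto simp: eventually_up)
  have r: "1 < sqrt t" "sqrt t * sqrt t = t"
    using t(1) by auto
  have "\<forall>\<^sub>F u in F. \<forall>v. below (sqrt t) u v \<longrightarrow> (\<forall>w. below (sqrt t) v w \<longrightarrow> P w)"
    using t(2)
  proof eventually_elim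
    case (elim u)
    then show ?case
      using below_trans[of "sqrt t" u _ "sqrt t"] r by auto
  qed
  then have "\<forall>\<^sub>F v in up F. \<forall>w. below (sqrt t) v w \<longrightarrow> P w"
    unfolding eventually_up using r(1) by blast
  then show "eventually P (up (up F))"
    unfolding eventually_up[of P] using r(1) by blast
qed

text \<open>A smaller closed filter demands more domination, so the maximal object is a minimal
  filter and Zorn's lemma is used with the order reversed. An event is eventual for the infimum of a
  nonempty chain only if it is so for one member, so a nontrivial meet with
  \<open>far_filter\<close> survives; closedness survives by monotonicity of
  \<open>up\<close>.\<close>

lemma ex_minimal_up_closed:
  obtains F where "up F \<le> F" "inf F far_filter \<noteq> bot"
    "\<And>G. up G \<le> G \<Longrightarrow> inf G far_filter \<noteq> bot \<Longrightarrow> G \<le> F \<Longrightarrow> G = F"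
proof -
  define \<S> where "\<S> = {F. up F \<le> F \<and> inf F far_filter \<noteq> bot}"
  let ?ge = "\<lambda>F G :: 'a filter. G \<le> F"
  have "\<exists>F\<in>\<S>. \<forall>G\<in>\<S>. G \<le> F \<longrightarrow> G = F"
  proof (rule predicate_Zorn[where P = ?ge and A = \<S>, simplified])
    show "partial_order_on \<S> (relation_of ?ge \<S>)"
      by (rule partial_order_on_relation_ofI) auto
    fix K
    assume K: "K \<in> Chains (relation_of ?ge \<S>)"
    have K_sub: "K \<subseteq> \<S>"
      using K by (auto simp: Chains_def relation_of_def)
    show "\<exists>F\<in>\<S>. \<forall>G\<in>K. F \<le> G"
    proof (cases "K = {}")
      case True
      then show ?thesis
        using far_filter_neq_bot by (auto simp: \<S>_def intro!: exI[of _ top])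
    next
      case False
      have ev: "eventually P (Inf K) \<longleftrightarrow> (\<exists>F\<in>K. eventually P F)" for P
      proof (rule eventually_Inf_base[OF False])
        fix F G assume "F \<in> K" "G \<in> K"
        then have "F \<le> G \<or> G \<le> F"
          using K by (auto simp: Chains_def relation_of_def)
        then show "\<exists>H\<in>K. H \<le> inf F G"
          using \<open>F \<in> K\<close> \<open>G \<in> K\<close> by (auto simp: inf_absorb1 inf_absorb2)
      qed
      have "up (Inf K) \<le> Inf K"
      proof (rule Inf_greatest)
        fix F assume "F \<in> K"
        then have "up (Inf K) \<le> up F"
          by (intro up_mono Inf_lower)
        also have "\<dots> \<le> F"
          using \<open>F \<in> K\<close> K_sub by (auto simp: \<S>_def)
        finally show "up (Inf K) \<le> F" .
      qed
      moreover have "inf (Inf K) far_filter \<noteq> bot"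
      proof
        assume "inf (Inf K) far_filter = bot"
        then have "eventually (\<lambda>_. False) (inf (Inf K) far_filter)"
          by simp
        then obtain F where "F \<in> K" "eventually (\<lambda>_. False) (inf F far_filter)"
          unfolding eventually_inf ev by blast
        then show False
          using K_sub by (auto simp: \<S>_def eventually_False)
      qed
      ultimately show ?thesis
        by (intro bexI[of _ "Inf K"]) (simp_all add: \<S>_def Inf_lower)
    qed
  qed
  then show thesis
    using that by (auto simp: \<S>_def)
qed

section \<open>Normalised short sums of two successive vectors\<close>

definition sum_filter :: "'a filter \<Rightarrow> 'a filter"
  where "sum_filter E = Abs_filter (\<lambda>P. \<exists>t>1. \<forall>\<^sub>F u in E. \<forall>\<^sub>F v in E. \<forall>s\<in>{1, - 1}.
    norm (u + s *\<^sub>R v) \<le> t \<longrightarrow> P (sgn (u + s *\<^sub>R v)))"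

text \<open>The quantifiers are iterated, v after u, so that v can be disjoint from u. Sums longer
  than t impose nothing; hence the filter is proper exactly when for every t > 1 sums of norm at
  most t keep occurring with one of the two signs.\<close>

lemma eventually_sum_filter:
  "eventually P (sum_filter E) \<longleftrightarrow> (\<exists>t>1. \<forall>\<^sub>F u in E. \<forall>\<^sub>F v in E. \<forall>s\<in>{1, - 1}.
    norm (u + s *\<^sub>R v) \<le> t \<longrightarrow> P (sgn (u + s *\<^sub>R v)))"
  unfolding sum_filter_def
proof (rule eventually_Abs_filter, rule is_filter.intro)
  let ?e = "\<lambda>P. \<exists>t>1. \<forall>\<^sub>F u in E. \<forall>\<^sub>F v in E. \<forall>s\<in>{1, - 1}.
    norm (u + s *\<^sub>R v) \<le> t \<longrightarrow> P (sgn (u + s *\<^sub>R v))"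
  show "?e (\<lambda>_. True)"
    by (intro exI[of _ 2]) auto
  fix P Q
  assume "?e P" "?e Q"
  then obtain t t' where t: "1 < t" "1 < t'" and ev:
      "\<forall>\<^sub>F u in E. \<forall>\<^sub>F v in E. \<forall>s\<in>{1, - 1}. norm (u + s *\<^sub>R v) \<le> t \<longrightarrow> P (sgn (u + s *\<^sub>R v))"
      "\<forall>\<^sub>F u in E. \<forall>\<^sub>F v in E. \<forall>s\<in>{1, - 1}. norm (u + s *\<^sub>R v) \<le> t' \<longrightarrow> Q (sgn (u + s *\<^sub>R v))"
    by blast
  from ev have "\<forall>\<^sub>F u in E. \<forall>\<^sub>F v in E. \<forall>s\<in>{1, - 1}. norm (u + s *\<^sub>R v) \<le> min t t' \<longrightarrow>
      P (sgn (u + s *\<^sub>R v)) \<and> Q (sgn (u + s *\<^sub>R v))"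
  proof eventually_elim
    case (elim u)
    then show ?case
      by eventually_elim auto
  qed
  then show "?e (\<lambda>w. P w \<and> Q w)"
    using t by (intro exI[of _ "min t t'"]) auto
next
  fix P Q :: "'a \<Rightarrow> bool"
  assume "\<forall>x. P x \<longrightarrow> Q x"
  then show "\<exists>t>1. \<forall>\<^sub>F u in E. \<forall>\<^sub>F v in E. \<forall>s\<in>{1, - 1}. norm (u + s *\<^sub>R v) \<le> t \<longrightarrow> Q (sgn (u + s *\<^sub>R v))"
    if "\<exists>t>1. \<forall>\<^sub>F u in E. \<forall>\<^sub>F v in E. \<forall>s\<in>{1, - 1}. norm (u + s *\<^sub>R v) \<le> t \<longrightarrow> P (sgn (u + s *\<^sub>R v))"
    using that by (auto elim!: eventually_mono ex_forward)
qed

lemma abs_c_eq_norm_mult: "\<bar>c i v\<bar> = norm v * \<bar>c i (sgn v)\<bar>"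
proof (cases "v = 0")
  case True
  then show ?thesis
    using linear_0[OF linear] by simp
qed (simp add: c_sgn abs_mult)

lemma below_sgn_add:
  assumes "disjoint_support u v" "s \<in> {1, - 1}" "norm (u + s *\<^sub>R v) \<le> t"
  shows "below t u (sgn (u + s *\<^sub>R v))"
  unfolding below_def
proof
  fix i
  have "\<bar>c i u\<bar> \<le> \<bar>c i (u + s *\<^sub>R v)\<bar>"
    using abs_c_add_disjoint[OF assms(1,2)] by simp
  also have "\<dots> = norm (u + s *\<^sub>R v) * \<bar>c i (sgn (u + s *\<^sub>R v))\<bar>"
    by (rule abs_c_eq_norm_mult)
  also have "\<dots> \<le> t * \<bar>c i (sgn (u + s *\<^sub>R v))\<bar>"
    using assms(3) by (intro mult_right_mono) auto
  finally show "\<bar>c i u\<bar> \<le> t * \<bar>c i (sgn (u + s *\<^sub>R v))\<bar>" .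
qed

lemma eventually_pair:
  assumes "E \<le> far_filter"
  shows "\<forall>\<^sub>F u in E. \<forall>\<^sub>F v in E. u \<in> V \<and> v \<in> V \<and> norm u = 1 \<and> norm v = 1 \<and> disjoint_support u v"
proof -
  have unit: "\<forall>\<^sub>F u in E. u \<in> V \<and> norm u = 1"
    using assms le_far_filter_iff by blast
  then show ?thesis
  proof eventually_elim
    case (elim u)
    with unit eventually_disjoint_support[OF assms, of u] show ?case
      by (auto elim: eventually_elim2)
  qed
qed

lemma sum_filter_le_far_filter:
  assumes E: "E \<le> far_filter"
  shows "sum_filter E \<le> far_filter"
  unfolding le_far_filter_iff
proof (intro conjI allI)
  \<comment> \<open>The bound 2 is an arbitrary number above 1.\<close>
  have "\<forall>\<^sub>F u in E. \<forall>\<^sub>F v in E. \<forall>s\<in>{1, - 1}. norm (u + s *\<^sub>R v) \<le> 2 \<longrightarrow>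
      sgn (u + s *\<^sub>R v) \<in> V \<and> norm (sgn (u + s *\<^sub>R v)) = 1"
    using eventually_pair[OF E]
  proof (rule eventually_mono, elim eventually_mono, intro ballI impI)
    fix u v and s :: real
    assume *: "u \<in> V \<and> v \<in> V \<and> norm u = 1 \<and> norm v = 1 \<and> disjoint_support u v"
      and s: "s \<in> {1, - 1}"
    have V: "u + s *\<^sub>R v \<in> V"
      using * subspace by (auto intro: subspace_add subspace_scale)
    \<comment> \<open>Unconditionality keeps the sum away from 0, so it can be normalised.\<close>
    have "norm u \<le> C * norm (u + s *\<^sub>R v)"
      using * V s by (intro norm_le) (auto simp: abs_c_add_disjoint)
    then have "u + s *\<^sub>R v \<noteq> 0"
      using * by auto
    with V show "sgn (u + s *\<^sub>R v) \<in> V \<and> norm (sgn (u + s *\<^sub>R v)) = 1"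
      using subspace_scale[OF subspace] by (simp add: norm_sgn sgn_div_norm[of "u + s *\<^sub>R v"])
  qed
  then show "\<forall>\<^sub>F v in sum_filter E. v \<in> V \<and> norm v = 1"
    unfolding eventually_sum_filter by (intro exI[of _ 2]) auto
  fix i
  have 0: "\<forall>\<^sub>F u in E. c i u = 0"
    using E le_far_filter_iff by blast
  then have "\<forall>\<^sub>F u in E. \<forall>\<^sub>F v in E. \<forall>s\<in>{1, - 1}. norm (u + s *\<^sub>R v) \<le> 2 \<longrightarrow> c i (sgn (u + s *\<^sub>R v)) = 0"
  proof eventually_elim
    case (elim u)
    with 0 show ?case
      by (auto elim!: eventually_mono simp: c_sgn c_simps)
  qed
  then show "\<forall>\<^sub>F v in sum_filter E. c i v = 0"
    unfolding eventually_sum_filter by (intro exI[of _ 2]) auto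
qed

text \<open>If short sums were eventually absent, a sequence could be selected along E whose sums
  and differences are all longer than some t > 1.\<close>

lemma sum_filter_neq_bot:
  assumes E: "E \<le> far_filter" "E \<noteq> bot" and "\<not> sphere_separates TYPE('a)"
  shows "sum_filter E \<noteq> bot"
proof
  assume "sum_filter E = bot"
  then obtain t where t: "1 < t"
      and ev: "\<forall>\<^sub>F u in E. \<forall>\<^sub>F v in E. \<forall>s\<in>{1, - 1}. \<not> norm (u + s *\<^sub>R v) \<le> t"
    using eventually_sum_filter[of "\<lambda>_. False" E] by auto
  have "\<forall>\<^sub>F u in E. norm u = 1"
    using E(1) by (auto simp: le_far_filter_iff elim: eventually_mono)
  from filter_selects_sequence[OF E(2) this ev] obtain x :: "nat \<Rightarrow> 'a"
    where x: "\<And>n. norm (x n) = 1" "\<And>n k. k < n \<Longrightarrow> t < norm (x k + x n) \<and> t < norm (x k - x n)"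
    by (auto simp: not_le)
  have "symmetrically_separated t x"
    unfolding symmetrically_separated_def
  proof (intro allI impI)
    fix n k :: nat
    assume "n \<noteq> k"
    then consider "k < n" | "n < k"
      by linarith
    then show "t \<le> norm (x n + x k) \<and> t \<le> norm (x n - x k)"
      by cases (use x(2)[of k n] x(2)[of n k] in \<open>auto simp: add.commute norm_minus_commute\<close>)
  qed
  with x(1) t have "sphere_separates TYPE('a)"
    unfolding sphere_separates_def by (intro exI[of _ "t - 1"] conjI exI[of _ x]) auto
  with assms(3) show False ..
qed

text \<open>A normalised short sum dominates its first summand up to the norm of the sum. One factor
  sqrt t pays for that norm, the other for the domination inside \<open>up\<close>.\<close>

lemma up_sum_filter_le:
  assumes E: "E \<le> far_filter"
  shows "up (sum_filter E) \<le> up E"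
proof (rule filter_leI)
  fix P assume "eventually P (up E)"
  then obtain t where t: "1 < t" "\<forall>\<^sub>F u in E. \<forall>v. below t u v \<longrightarrow> P v"
    by (auto simp: eventually_up)
  have r: "1 < sqrt t" "sqrt t * sqrt t = t" "0 \<le> sqrt t"
    using t(1) by auto
  from t(2) eventually_pair[OF E] have "\<forall>\<^sub>F u in E. \<forall>\<^sub>F v in E. \<forall>s\<in>{1, - 1}.
      norm (u + s *\<^sub>R v) \<le> sqrt t \<longrightarrow> (\<forall>w. below (sqrt t) (sgn (u + s *\<^sub>R v)) w \<longrightarrow> P w)"
  proof eventually_elim
    case (elim u)
    from elim(2) show ?case
    proof eventually_elim
      case (elim v)
      show ?case
      proof (intro ballI impI allI)
        fix s w
        assume "s \<in> {1, - 1}" "norm (u + s *\<^sub>R v) \<le> sqrt t" "below (sqrt t) (sgn (u + s *\<^sub>R v)) w"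
        with elim have "below t u w"
          using below_trans[OF below_sgn_add _ r(3)] r(2) by metis
        with \<open>\<forall>v. below t u v \<longrightarrow> P v\<close> show "P w"
          by blast
      qed
    qed
  qed
  then have "\<forall>\<^sub>F v in sum_filter E. \<forall>w. below (sqrt t) v w \<longrightarrow> P w"
    unfolding eventually_sum_filter using r(1) by blast
  then show "eventually P (up (sum_filter E))"
    unfolding eventually_up[of P] using r(1) by blast
qed

section \<open>A filter that absorbs its own sums\<close>

lemma ex_absorbing_filter:
  assumes "\<not> sphere_separates TYPE('a)"
  obtains E where "E \<noteq> bot" "E \<le> far_filter" "E \<le> up (sum_filter E)"
proof -
  obtain F where F: "up F \<le> F" "inf F far_filter \<noteq> bot"
      and minimal: "\<And>G. up G \<le> G \<Longrightarrow> inf G far_filter \<noteq> bot \<Longrightarrow> G \<le> F \<Longrightarrow> G = F"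
    by (rule ex_minimal_up_closed) blast
  define E where "E = inf F far_filter"
  have E: "E \<le> far_filter" "E \<le> F" "E \<noteq> bot"
    using F(2) by (auto simp: E_def)
  \<comment> \<open>The closure of the sums is closed, lies under F and meets
    \<open>far_filter\<close>, so minimality makes it F itself. Then E \<le> F is domination in the
    reverse direction: members of E almost dominate normalised sums of members of E.\<close>
  have "up (sum_filter E) = F"
  proof (rule minimal[OF up_up])
    have "sum_filter E \<le> inf (up (sum_filter E)) far_filter"
      using le_up sum_filter_le_far_filter[OF E(1)] by (rule le_infI)
    then show "inf (up (sum_filter E)) far_filter \<noteq> bot"
      using sum_filter_neq_bot[OF E(1,3) assms] by (metis bot.extremum_uniqueI)
    have "up (sum_filter E) \<le> up E"
      by (rule up_sum_filter_le[OF E(1)])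
    also have "\<dots> \<le> up F"
      by (rule up_mono[OF E(2)])
    finally show "up (sum_filter E) \<le> F"
      using F(1) by simp
  qed
  with that E show thesis
    by simp
qed

text \<open>Contraposition. If the vectors (u + v) / t avoid B, so do the normalised short sums
  divided by r = sqrt t, which dominate them. By solidity B is then avoided by everything that
  dominates a normalised sum within the factor r, hence eventually along E.\<close>

lemma frequently_add_in_solid:
  assumes E: "E \<le> far_filter" "E \<le> up (sum_filter E)" and "1 < t"
    and solid: "\<And>u v. u \<in> V \<Longrightarrow> v \<in> B \<Longrightarrow> below 1 u v \<Longrightarrow> u \<in> B"
    and freq: "\<exists>\<^sub>F v in E. v \<in> B"
  shows "\<exists>\<^sub>F u in E. \<exists>\<^sub>F v in E. (1 / t) *\<^sub>R (u + v) \<in> B"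
proof (rule ccontr)
  assume "\<not> ?thesis"
  then have not_in: "\<forall>\<^sub>F u in E. \<forall>\<^sub>F v in E. (1 / t) *\<^sub>R (u + v) \<notin> B"
    by (simp add: not_frequently)
  define r where "r = sqrt t"
  have r: "1 < r" "r * r = t"
    using assms(3) by (auto simp: r_def)
  let ?W = "\<lambda>w. w \<in> V \<and> (1 / r) *\<^sub>R w \<notin> B"
  from not_in eventually_pair[OF E(1)] have "\<forall>\<^sub>F u in E. \<forall>\<^sub>F v in E. \<forall>s\<in>{1, - 1}.
      norm (u + s *\<^sub>R v) \<le> r \<longrightarrow> ?W (sgn (u + s *\<^sub>R v))"
  proof eventually_elim
    case (elim u)
    from elim show ?case
    proof eventually_elim
      case (elim v)
      show ?case
      proof (intro ballI impI conjI notI)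
        fix s :: real
        assume s: "s \<in> {1, - 1}" and le: "norm (u + s *\<^sub>R v) \<le> r"
        let ?x = "u + s *\<^sub>R v"
        show "sgn ?x \<in> V"
          unfolding sgn_div_norm using elim subspace by (auto intro!: subspace_add subspace_scale)
        assume in_B: "(1 / r) *\<^sub>R sgn ?x \<in> B"
        \<comment> \<open>Disjoint supports allow u + v in place of u + s v, and the norm of the
          latter, at most r, uses up one factor of t = r * r.\<close>
        have "below 1 ((1 / t) *\<^sub>R (u + v)) ((1 / r) *\<^sub>R sgn ?x)"
          unfolding below_def
        proof
          fix i
          have "\<bar>c i (u + v)\<bar> = \<bar>c i ?x\<bar>"
            using abs_c_add_disjoint[of u v s i] abs_c_add_disjoint[of u v 1 i] elim s by simp
          also have "\<dots> \<le> r * \<bar>c i (sgn ?x)\<bar>"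
            unfolding abs_c_eq_norm_mult[of i ?x] using le by (intro mult_right_mono) auto
          finally have "\<bar>c i (u + v)\<bar> / t \<le> r * \<bar>c i (sgn ?x)\<bar> / t"
            using assms(3) by (intro divide_right_mono) auto
          also have "\<dots> = \<bar>c i (sgn ?x)\<bar> / r"
            using r by (simp flip: r(2))
          finally show "\<bar>c i ((1 / t) *\<^sub>R (u + v))\<bar> \<le> 1 * \<bar>c i ((1 / r) *\<^sub>R sgn ?x)\<bar>"
            using r assms(3) by (simp add: linear_scale[OF linear] abs_mult)
        qed
        moreover have "(1 / t) *\<^sub>R (u + v) \<in> V"
          using elim subspace by (auto intro!: subspace_add subspace_scale)
        ultimately have "(1 / t) *\<^sub>R (u + v) \<in> B"
          using in_B solid by blast
        with elim show False
          by blast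
      qed
    qed
  qed
  then have "\<forall>\<^sub>F w in sum_filter E. ?W w"
    unfolding eventually_sum_filter using r(1) by blast
  then have "\<forall>\<^sub>F w in sum_filter E. \<forall>v. below r w v \<longrightarrow> v \<notin> B"
  proof (rule eventually_mono, intro allI impI notI)
    fix w v
    assume w: "?W w" and "below r w v" "v \<in> B"
    have "below 1 ((1 / r) *\<^sub>R w) v"
      using \<open>below r w v\<close> r(1)
      by (auto simp: below_def linear_scale[OF linear] abs_mult field_simps)
    moreover have "(1 / r) *\<^sub>R w \<in> V"
      using w subspace by (auto intro: subspace_scale)
    ultimately have "(1 / r) *\<^sub>R w \<in> B"
      using \<open>v \<in> B\<close> solid by blast
    with w show False
      by blast
  qed
  then have "eventually (\<lambda>v. v \<notin> B) (up (sum_filter E))"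
    unfolding eventually_up using r(1) by blast
  then have "eventually (\<lambda>v. v \<notin> B) E"
    using E(2) filter_leD by blast
  with freq show False
    by (simp add: frequently_def)
qed

text \<open>The norm need not be monotone in the absolute coordinates, so the unit ball is replaced
  by a solid set. By \<open>norm_le\<close> it contains all unit vectors of V.\<close>

definition solid_ball :: "'a set"
  where "solid_ball = {v \<in> V. \<forall>u\<in>V. below 1 u v \<longrightarrow> norm u \<le> C}"

lemma solid_ball_solid:
  assumes "u \<in> V" "v \<in> solid_ball" "below 1 u v"
  shows "u \<in> solid_ball"
  using assms below_trans[of 1 _ u 1 v] by (auto simp: solid_ball_def)

text \<open>The admissible increments of S form a solid set B, so B frequently contains sums u + v
  shrunk by \<tau> / \<tau>'. Shrinking S by the same ratio stays inside the solid ball. Then u is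
  the next term, and v keeps the place of the terms to come.\<close>

lemma extend_in_solid_ball:
  assumes E: "E \<le> far_filter" "E \<le> up (sum_filter E)"
    and "S \<in> V" "0 < \<tau>" "\<tau> < \<tau>'" and freq: "\<exists>\<^sub>F v in E. (1 / \<tau>) *\<^sub>R (S + v) \<in> solid_ball"
  shows "\<exists>u\<in>V. norm u = 1 \<and> disjoint_support S u \<and> (\<exists>\<^sub>F v in E. (1 / \<tau>') *\<^sub>R (S + u + v) \<in> solid_ball)"
proof -
  define B where "B = {v \<in> V. disjoint_support S v \<and> (1 / \<tau>) *\<^sub>R (S + v) \<in> solid_ball}"
  have unit: "\<forall>\<^sub>F v in E. v \<in> V \<and> norm v = 1"
    using E(1) le_far_filter_iff by blast
  have disj: "\<forall>\<^sub>F v in E. disjoint_support S v"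
    using eventually_disjoint_support[OF E(1) assms(3)] .
  have add_eq: "\<bar>c i (S + v)\<bar> = \<bar>c i S\<bar> + \<bar>c i v\<bar>" if "disjoint_support S v" for v i
    using abs_c_add_disjoint[OF that, of 1] by simp
  have "\<exists>\<^sub>F v in E. v \<in> B"
    using frequently_eventually_conj[OF frequently_eventually_conj[OF freq disj] unit]
    by (rule frequently_elim1) (auto simp: B_def)
  moreover have "u \<in> B" if "u \<in> V" "v \<in> B" "below 1 u v" for u v
  proof -
    have disj: "disjoint_support S u" "disjoint_support S v"
      using that by (auto simp: disjoint_support_def B_def below_def) (metis abs_le_zero_iff abs_zero)
    have "below 1 ((1 / \<tau>) *\<^sub>R (S + u)) ((1 / \<tau>) *\<^sub>R (S + v))"
      using that(3) assms(4) disj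
      by (auto simp: below_def linear_scale[OF linear] abs_mult add_eq divide_right_mono)
    moreover have "(1 / \<tau>) *\<^sub>R (S + u) \<in> V"
      using that assms subspace by (auto intro!: subspace_add subspace_scale)
    moreover have "(1 / \<tau>) *\<^sub>R (S + v) \<in> solid_ball"
      using that(2) by (simp add: B_def)
    ultimately have "(1 / \<tau>) *\<^sub>R (S + u) \<in> solid_ball"
      using solid_ball_solid by blast
    then show ?thesis
      using that(1) disj(1) by (simp add: B_def)
  qed
  moreover have "1 < \<tau>' / \<tau>"
    using assms by simp
  ultimately have freq_B: "\<exists>\<^sub>F u in E. \<exists>\<^sub>F v in E. (1 / (\<tau>' / \<tau>)) *\<^sub>R (u + v) \<in> B"
    using frequently_add_in_solid[OF E] by blast
  obtain u where u: "u \<in> V" "norm u = 1" "disjoint_support S u"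
      and freq_u: "\<exists>\<^sub>F v in E. (\<tau> / \<tau>') *\<^sub>R (u + v) \<in> B"
    using frequently_ex[OF frequently_eventually_conj[OF frequently_eventually_conj[OF freq_B disj] unit]]
    by auto
  have in_ball: "(1 / \<tau>') *\<^sub>R (S + u + v) \<in> solid_ball"
    if v: "v \<in> V" and disj: "disjoint_support S v" and in_B: "(\<tau> / \<tau>') *\<^sub>R (u + v) \<in> B" for v
  proof -
    let ?x = "(\<tau> / \<tau>') *\<^sub>R (u + v)"
    have x: "disjoint_support S ?x" "(1 / \<tau>) *\<^sub>R (S + ?x) \<in> solid_ball"
      using in_B by (auto simp: B_def)
    have uv: "disjoint_support S (u + v)"
      using u(3) disj by (auto simp: disjoint_support_def c_simps) (metis add_0)
    have "below 1 ((1 / \<tau>') *\<^sub>R (S + (u + v))) ((1 / \<tau>) *\<^sub>R (S + ?x))"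
      unfolding below_def
    proof
      fix i
      have "\<bar>c i S\<bar> / \<tau>' \<le> \<bar>c i S\<bar> / \<tau>"
        using assms by (intro divide_left_mono) auto
      then have "\<bar>1 / \<tau>'\<bar> * (\<bar>c i S\<bar> + \<bar>c i (u + v)\<bar>) \<le> \<bar>1 / \<tau>\<bar> * (\<bar>c i S\<bar> + \<bar>\<tau> / \<tau>'\<bar> * \<bar>c i (u + v)\<bar>)"
        using assms by (simp add: field_simps)
      then show "\<bar>c i ((1 / \<tau>') *\<^sub>R (S + (u + v)))\<bar> \<le> 1 * \<bar>c i ((1 / \<tau>) *\<^sub>R (S + ?x))\<bar>"
        unfolding linear_scale[OF linear] real_scaleR_def abs_mult add_eq[OF x(1)] add_eq[OF uv] by simp
    qed
    moreover have "(1 / \<tau>') *\<^sub>R (S + (u + v)) \<in> V"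
      using u v assms subspace by (auto intro!: subspace_add subspace_scale)
    ultimately show ?thesis
      using x(2) solid_ball_solid by (auto simp: add.assoc)
  qed
  have "\<exists>\<^sub>F v in E. (1 / \<tau>') *\<^sub>R (S + u + v) \<in> solid_ball"
    using frequently_eventually_conj[OF frequently_eventually_conj[OF freq_u disj] unit]
    by (rule frequently_elim1) (use in_ball in blast)
  with u show ?thesis
    by blast
qed

theorem sphere_separates: "sphere_separates TYPE('a)"
proof (rule ccontr)
  assume neg: "\<not> ?thesis"
  then obtain E where E: "E \<noteq> bot" "E \<le> far_filter" "E \<le> up (sum_filter E)"
    by (rule ex_absorbing_filter)
  have unit: "\<forall>\<^sub>F v in E. v \<in> V \<and> norm v = 1"
    using E(2) le_far_filter_iff by blast
  \<comment> \<open>Strict growth from 1 towards 2: every extension has a factor \<tau> (Suc n) /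
    \<tau> n > 1 to spend, and the total loss stays below 2.\<close>
  define \<tau> :: "nat \<Rightarrow> real" where "\<tau> n = 2 - (1/2) ^ n" for n
  have \<tau>: "0 < \<tau> n" "\<tau> n < \<tau> (Suc n)" "\<tau> n \<le> 2" for n
  proof -
    show "\<tau> n < \<tau> (Suc n)" "\<tau> n \<le> 2"
      by (simp_all add: \<tau>_def)
    have "(1/2 :: real) ^ n \<le> 1"
      by (rule power_le_one) auto
    then show "0 < \<tau> n"
      by (simp add: \<tau>_def)
  qed
  let ?P = "\<lambda>n S. S \<in> V \<and> (\<exists>\<^sub>F v in E. (1 / \<tau> n) *\<^sub>R (S + v) \<in> solid_ball)"
  let ?Q = "\<lambda>S S'. \<exists>u\<in>V. norm u = 1 \<and> disjoint_support S u \<and> S' = S + u"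
  have "\<exists>S. \<forall>n. ?P n (S n) \<and> ?Q (S n) (S (Suc n))"
  proof (rule dependent_nat_choice)
    have "\<forall>\<^sub>F v in E. (1 / \<tau> 0) *\<^sub>R (0 + v) \<in> solid_ball"
      using unit
    proof eventually_elim
      case (elim v)
      then show ?case
        using norm_le[of _ v] by (auto simp: \<tau>_def solid_ball_def below_def)
    qed
    then show "\<exists>S. ?P 0 S"
      using subspace_0[OF subspace] E(1) eventually_frequently by blast
    show "\<exists>S'. ?P (Suc n) S' \<and> ?Q S S'" if "?P n S" for S n
      using extend_in_solid_ball[OF E(2,3) _ \<tau>(1,2)] that subspace_add[OF subspace] by blast
  qed
  then obtain S where S: "\<And>n. S n \<in> V" "\<And>n. \<exists>\<^sub>F v in E. (1 / \<tau> n) *\<^sub>R (S n + v) \<in> solid_ball"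
      "\<And>n. ?Q (S n) (S (Suc n))"
    by auto
  then obtain x where x: "\<And>n. x n \<in> V" "\<And>n. norm (x n) = 1" "\<And>n. disjoint_support (S n) (x n)"
      "\<And>n. S (Suc n) = S n + x n"
    by metis
  have c_sum: "(\<Sum>k<n. \<bar>c i (x k)\<bar>) \<le> \<bar>c i (S n)\<bar>" for n i
  proof (induction n)
    case (Suc n)
    then show ?case
      using abs_c_add_disjoint[OF x(3)[of n], of 1] by (simp add: x(4))
  qed simp
  have "norm (\<Sum>k<n. \<alpha> k *\<^sub>R x k) \<le> 2 * C" if \<alpha>: "\<And>k. \<bar>\<alpha> k\<bar> \<le> 1" for n \<alpha>
  proof -
    let ?y = "\<Sum>k<n. \<alpha> k *\<^sub>R x k"
    have y: "?y \<in> V"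
      using x(1) subspace by (auto intro!: subspace_sum subspace_scale)
    have c_y: "\<bar>c i ?y\<bar> \<le> \<bar>c i (S n)\<bar>" for i
    proof -
      have "\<bar>c i ?y\<bar> \<le> (\<Sum>k<n. \<bar>\<alpha> k * c i (x k)\<bar>)"
        by (simp add: linear_sum[OF linear] linear_scale[OF linear] sum_abs)
      also have "\<dots> \<le> (\<Sum>k<n. \<bar>c i (x k)\<bar>)"
        using \<alpha> by (intro sum_mono) (auto simp: abs_mult mult_left_le_one_le)
      finally show ?thesis
        using c_sum by (rule order_trans)
    qed
    \<comment> \<open>The vector v is disjoint from \<open>S n\<close> and only enlarges its
      absolute coordinates. Below, the factor 1/2 works for all n because \<tau> n \<le> 2.\<close>
    obtain v where v: "disjoint_support (S n) v" "(1 / \<tau> n) *\<^sub>R (S n + v) \<in> solid_ball"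
      using frequently_eventually_conj[OF S(2) eventually_disjoint_support[OF E(2) S(1)]]
        frequently_ex by blast
    have "below 1 ((1/2) *\<^sub>R ?y) ((1 / \<tau> n) *\<^sub>R (S n + v))"
      unfolding below_def
    proof
      fix i
      have "\<bar>c i ?y\<bar> \<le> \<bar>c i (S n + v)\<bar>"
        using c_y[of i] abs_c_add_disjoint[OF v(1), of 1 i] by simp
      then have "\<bar>c i ?y\<bar> / 2 \<le> \<bar>c i (S n + v)\<bar> / \<tau> n"
        using \<tau>[of n] by (intro frac_le) auto
      then show "\<bar>c i ((1/2) *\<^sub>R ?y)\<bar> \<le> 1 * \<bar>c i ((1 / \<tau> n) *\<^sub>R (S n + v))\<bar>"
        unfolding linear_scale[OF linear] using \<tau>[of n] by (simp add: abs_mult)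
    qed
    moreover have "(1/2) *\<^sub>R ?y \<in> V"
      using y subspace by (auto intro: subspace_scale)
    ultimately have "norm ((1/2) *\<^sub>R ?y) \<le> C"
      using v(2) by (auto simp: solid_ball_def)
    then show ?thesis
      by simp
  qed
  then have "sphere_separates TYPE('a)"
    using sphere_separates_if_c0[of x "2 * C"] x(2) by blast
  with neg show False ..
qed

end

section \<open>Unconditional sequences\<close>

text \<open>Absolute coefficients are compared, instead of signs being changed. This form also
  bounds the projections onto single coordinates, so linear independence comes with it.\<close>

definition unconditional_sequence :: "(nat \<Rightarrow> 'a::real_normed_vector) \<Rightarrow> bool"
  where "unconditional_sequence e \<longleftrightarrow> (\<forall>n. e n \<noteq> 0) \<and>
    (\<exists>C. \<forall>n a b. (\<forall>i. \<bar>b i\<bar> \<le> \<bar>a i\<bar>) \<longrightarrow>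
      norm (\<Sum>i<n. b i *\<^sub>R e i) \<le> C * norm (\<Sum>i<n. a i *\<^sub>R e i))"

lemma in_span_rangeD:
  fixes e :: "nat \<Rightarrow> 'a::real_vector"
  assumes "v \<in> span (range e)"
  shows "\<exists>n a. v = (\<Sum>i<n. a i *\<^sub>R e i)"
  using assms
proof (induction rule: span_induct_alt)
  case base
  show ?case
    by (rule exI[of _ 0]) simp
next
  case (step r x y)
  then obtain n a k where y: "y = (\<Sum>i<n. a i *\<^sub>R e i)" and x: "x = e k"
    by auto
  let ?m = "max n (Suc k)"
  let ?a = "\<lambda>i. (if i < n then a i else 0)"
  have "y = (\<Sum>i<?m. ?a i *\<^sub>R e i)"
    unfolding y by (rule sum.mono_neutral_cong_left) auto
  moreover have "(\<Sum>i<?m. (if i = k then r else 0) *\<^sub>R e i) = (\<Sum>i<?m. (if i = k then r *\<^sub>R e i else 0))"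
    by (rule sum.cong) auto
  then have "r *\<^sub>R x = (\<Sum>i<?m. (if i = k then r else 0) *\<^sub>R e i)"
    by (simp add: x less_max_iff_disj)
  ultimately have "r *\<^sub>R x + y = (\<Sum>i<?m. ((if i = k then r else 0) + ?a i) *\<^sub>R e i)"
    unfolding scaleR_add_left sum.distrib by simp
  then show ?case
    by (intro exI)
qed

theorem sphere_separates_if_unconditional_sequence:
  fixes e :: "nat \<Rightarrow> 'a::real_normed_vector"
  assumes "unconditional_sequence e"
  shows "sphere_separates TYPE('a)"
proof -
  obtain C where e0: "\<And>n. e n \<noteq> 0" and C: "\<And>n a b. (\<And>i. \<bar>b i\<bar> \<le> \<bar>a i\<bar>) \<Longrightarrow>
      norm (\<Sum>i<n. b i *\<^sub>R e i) \<le> C * norm (\<Sum>i<n. a i *\<^sub>R e i)"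
    using assms unfolding unconditional_sequence_def by blast
  \<comment> \<open>Keeping a single coefficient is a case of the inequality, hence a vanishing
    combination has vanishing coefficients.\<close>
  have zero: "a j = 0" if "(\<Sum>i<n. a i *\<^sub>R e i) = 0" "j < n" for a n j
  proof -
    have "norm (\<Sum>i<n. (if i = j then a i else 0) *\<^sub>R e i) \<le> C * norm (\<Sum>i<n. a i *\<^sub>R e i)"
      by (rule C) auto
    also have "(\<Sum>i<n. (if i = j then a i else 0) *\<^sub>R e i) = (\<Sum>i<n. if i = j then a i *\<^sub>R e i else 0)"
      by (rule sum.cong) auto
    finally have "norm (a j *\<^sub>R e j) \<le> 0"
      using that by simp
    then show ?thesis
      using e0 by (metis norm_le_zero_iff scaleR_eq_0_iff)
  qed
  have "inj e"
  proof (rule injI, rule ccontr)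
    fix j k assume "e j = e k" "j \<noteq> k"
    obtain n where n: "j < n" "k < n"
      by (metis less_max_iff_disj lessI)
    have "(\<Sum>i<n. ((if i = j then 1 else 0) - (if i = k then 1 else 0)) *\<^sub>R e i)
        = (\<Sum>i<n. (if i = j then e i else 0) - (if i = k then e i else 0))"
      by (rule sum.cong) auto
    also have "\<dots> = (\<Sum>i<n. if i = j then e i else 0) - (\<Sum>i<n. if i = k then e i else 0)"
      by (rule sum_subtractf)
    also have "\<dots> = 0"
      using n \<open>e j = e k\<close> by simp
    finally have "(if j = j then 1 else 0) - (if j = k then 1 else 0) = (0 :: real)"
      by (rule zero) (rule n)
    then show False
      using \<open>j \<noteq> k\<close> by simp
  qed
  have indep: "independent (range e)"
  proof
    assume "dependent (range e)"
    then obtain t u w where t: "finite t" "t \<subseteq> range e" "(\<Sum>v\<in>t. u v *\<^sub>R v) = 0" "w \<in> t" "u w \<noteq> 0"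
      unfolding dependent_explicit by blast
    have fin: "finite (e -` t)"
      using \<open>inj e\<close> t(1) by (rule finite_vimageI[rotated])
    obtain k where k: "w = e k"
      using t by auto
    let ?n = "Suc (Max (e -` t))"
    let ?a = "\<lambda>i. if e i \<in> t then u (e i) else 0"
    have "(\<Sum>i<?n. ?a i *\<^sub>R e i) = (\<Sum>i\<in>e -` t. u (e i) *\<^sub>R e i)"
      by (rule sum.mono_neutral_cong_right) (use fin in \<open>auto simp: less_Suc_eq_le\<close>)
    also have "\<dots> = (\<Sum>v\<in>t. u v *\<^sub>R v)"
      by (rule sum.reindex_cong[of e, symmetric])
        (use \<open>inj e\<close> t(2) in \<open>auto simp: inj_on_def inj_def\<close>)
    finally have "?a k = 0"
      unfolding t(3) by (rule zero) (use fin k t(4) in \<open>auto simp: less_Suc_eq_le\<close>)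
    then show False
      using k t(4,5) by simp
  qed
  \<comment> \<open>Extended from an independent set to the whole space, these functionals may be
    discontinuous; only their values on the span of the sequence matter.\<close>
  have "\<exists>g. linear g \<and> (\<forall>x\<in>range e. g x = (if x = e i then 1 else 0 :: real))" for i
    by (rule linear_independent_extend[OF indep])
  then obtain c where lin: "\<And>i. linear (c i :: 'a \<Rightarrow> real)"
      and "\<And>i x. x \<in> range e \<Longrightarrow> c i x = (if x = e i then 1 else 0)"
    by metis
  then have c_e: "c i (e j) = (if i = j then 1 else 0)" for i j
    using \<open>inj e\<close> by (auto simp: inj_def)
  have c_sum: "c i (\<Sum>j<n. a j *\<^sub>R e j) = (if i < n then a i else 0)" for i n a
  proof -
    have "c i (\<Sum>j<n. a j *\<^sub>R e j) = (\<Sum>j<n. if i = j then a j else 0)"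
      unfolding linear_sum[OF lin] linear_scale[OF lin] c_e by (rule sum.cong) auto
    then show ?thesis
      by simp
  qed
  have expand: "v = (\<Sum>i<m. c i v *\<^sub>R e i)" if "v = (\<Sum>j<n. a j *\<^sub>R e j)" "n \<le> m" for v n m a
    unfolding that(1) c_sum by (rule sum.mono_neutral_cong_left) (use that(2) in auto)
  interpret solid_coordinates "span (range e)" c C
  proof (rule solid_coordinates.intro)
    show "finite {i. c i v \<noteq> 0}" if v_in: "v \<in> span (range e)" for v
    proof -
      obtain n a where v: "v = (\<Sum>j<n. a j *\<^sub>R e j)"
        using in_span_rangeD[OF v_in] by blast
      have "{i. c i v \<noteq> 0} \<subseteq> {..<n}"
        unfolding v c_sum by auto
      then show ?thesis
        by (rule finite_subset) simp
    qed
    show "norm u \<le> C * norm v"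
      if uv: "u \<in> span (range e)" "v \<in> span (range e)" and le: "\<And>i. \<bar>c i u\<bar> \<le> \<bar>c i v\<bar>" for u v
    proof -
      obtain n a m b where "u = (\<Sum>j<n. a j *\<^sub>R e j)" "v = (\<Sum>j<m. b j *\<^sub>R e j)"
        using in_span_rangeD uv by metis
      then have "(\<Sum>i<max n m. c i u *\<^sub>R e i) = u" "(\<Sum>i<max n m. c i v *\<^sub>R e i) = v"
        by (auto intro: expand[symmetric])
      then show ?thesis
        using C[of "\<lambda>i. c i u" "\<lambda>i. c i v" "max n m"] le by simp
    qed
    show "\<exists>v\<in>span (range e). v \<noteq> 0 \<and> (\<forall>i<n. c i v = 0)" for n
      using e0[of n] by (intro bexI[of _ "e n"]) (auto simp: c_e span_base)
  qed (simp_all only: lin subspace_span)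
  show ?thesis
    by (rule sphere_separates)
qed

lemma unconditional_sequence_image:
  assumes "unconditional_sequence d" "linear T" "0 < m"
    and bounds: "\<And>x. m * norm x \<le> norm (T x)" "\<And>x. norm (T x) \<le> M * norm x"
  shows "unconditional_sequence (\<lambda>n. T (d n))"
  unfolding unconditional_sequence_def
proof (intro conjI allI)
  obtain C where d0: "\<And>n. d n \<noteq> 0" and C: "\<And>n a b. (\<And>i. \<bar>b i\<bar> \<le> \<bar>a i\<bar>) \<Longrightarrow>
      norm (\<Sum>i<n. b i *\<^sub>R d i) \<le> C * norm (\<Sum>i<n. a i *\<^sub>R d i)"
    using assms(1) unfolding unconditional_sequence_def by blast
  show "T (d n) \<noteq> 0" for n
    using bounds(1)[of "d n"] d0[of n] assms(3) by (auto simp: mult_le_0_iff)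
  have M: "0 \<le> M"
    using bounds(2)[of "d 0"] d0[of 0] by (metis norm_ge_zero order_trans zero_le_mult_iff zero_less_norm_iff not_le)
  have C0: "0 \<le> C"
    using C[of "\<lambda>_. 0" "\<lambda>_. 1" 1] d0[of 0] by (simp add: zero_le_mult_iff)
  have T_sum: "(\<Sum>i<n. a i *\<^sub>R T (d i)) = T (\<Sum>i<n. a i *\<^sub>R d i)" for a n
    by (simp add: linear_sum[OF assms(2)] linear_scale[OF assms(2)])
  show "\<exists>C. \<forall>n a b. (\<forall>i. \<bar>b i\<bar> \<le> \<bar>a i\<bar>) \<longrightarrow>
      norm (\<Sum>i<n. b i *\<^sub>R T (d i)) \<le> C * norm (\<Sum>i<n. a i *\<^sub>R T (d i))"
    unfolding T_sum
  proof (intro exI[of _ "M * C / m"] allI impI)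
    fix n and a b :: "nat \<Rightarrow> real"
    assume ab: "\<forall>i. \<bar>b i\<bar> \<le> \<bar>a i\<bar>"
    let ?a = "\<Sum>i<n. a i *\<^sub>R d i" and ?b = "\<Sum>i<n. b i *\<^sub>R d i"
    have "norm (T ?b) \<le> M * norm ?b"
      by (rule bounds)
    also have "\<dots> \<le> M * (C * norm ?a)"
      using M C ab by (intro mult_left_mono) auto
    also have "\<dots> \<le> M * (C * (norm (T ?a) / m))"
      using M C0 bounds(1)[of ?a] assms(3) by (intro mult_left_mono) (auto simp: field_simps)
    finally show "norm (T ?b) \<le> M * C / m * norm (T ?a)"
      by simp
  qed
qed

text \<open>Continuity of T and of S at 0 yields one bound each by homogeneity. The 2 in 2 /
  \<delta> keeps the test vector strictly inside the \<delta>-ball.\<close>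

lemma linear_homeomorphism_bounds:
  fixes T :: "'b::real_normed_vector \<Rightarrow> 'a::real_normed_vector"
  assumes "linear T" "homeomorphism UNIV Y T S"
  obtains m M where "0 < m" "\<And>x. m * norm x \<le> norm (T x)" "\<And>x. norm (T x) \<le> M * norm x"
proof -
  have ST: "S (T x) = x" "T x \<in> Y" for x
    using assms(2) by (auto simp: homeomorphism_def)
  have T0: "T 0 = 0"
    using assms(1) by (rule linear_0)
  have "continuous_on UNIV T" "continuous_on Y S"
    using assms(2) by (auto simp: homeomorphism_def)
  then obtain \<delta> \<eta> where \<delta>: "0 < \<delta>" "\<And>x. norm x < \<delta> \<Longrightarrow> norm (T x) < 1"
      and \<eta>: "0 < \<eta>" "\<And>y. y \<in> Y \<Longrightarrow> norm y < \<eta> \<Longrightarrow> norm (S y) < 1"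
    unfolding continuous_on_iff using T0 ST(1)[of 0] ST(2)[of 0]
    by (metis UNIV_I dist_0_norm dist_commute zero_less_one)
  have lower: "\<eta> * norm x \<le> norm (T x)" for x
  proof (rule ccontr)
    assume *: "\<not> ?thesis"
    then have "x \<noteq> 0"
      using T0 by auto
    then have "norm (T (sgn x)) < \<eta>"
      using * by (simp add: sgn_div_norm linear_scale[OF assms(1)] field_simps)
    then have "norm (sgn x) < 1"
      using \<eta>(2)[OF ST(2)] ST(1) by metis
    then show False
      using \<open>x \<noteq> 0\<close> by (simp add: norm_sgn)
  qed
  have upper: "norm (T x) \<le> 2 / \<delta> * norm x" for x
  proof (cases "x = 0")
    case False
    have "norm ((\<delta> / 2) *\<^sub>R sgn x) < \<delta>"
      using \<delta>(1) False by (simp add: norm_sgn)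
    then have "norm (T ((\<delta> / 2) *\<^sub>R sgn x)) < 1"
      by (rule \<delta>(2))
    then show ?thesis
      using \<delta>(1) False by (simp add: sgn_div_norm linear_scale[OF assms(1)] field_simps)
  qed (simp add: T0)
  show thesis
    using that[OF \<eta>(1) lower upper] .
qed

section \<open>Disjoint sequences in Banach lattices\<close>

lemma inf_add_eq_0:
  fixes x y z :: "'a::lattice_ab_group_add"
  assumes "inf x z = 0" "inf y z = 0" "0 \<le> x" "0 \<le> y" "0 \<le> z"
  shows "inf (x + y) z = 0"
proof (rule antisym)
  have "inf (x + y) z \<le> inf (x + y) (z + y)"
    using assms by (intro inf_mono) auto
  also have "\<dots> = y"
    using assms by (simp flip: add_inf_distrib_right)
  finally show "inf (x + y) z \<le> 0"
    using assms(2) by (metis inf.bounded_iff inf.cobounded2)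
qed (use assms in auto)

text \<open>Additivity gives the natural multiples of x, and any real multiple lies below one of
  these.\<close>

lemma inf_scaleR_eq_0:
  fixes x y :: "'a::banach_lattice"
  assumes "inf x y = 0" "0 \<le> t"
  shows "inf (t *\<^sub>R x) y = 0"
proof -
  have nonneg: "0 \<le> x" "0 \<le> y"
    using assms(1) by (metis inf.cobounded1, metis inf.cobounded2)
  have nat: "inf (real n *\<^sub>R x) y = 0" for n
  proof (induction n)
    case (Suc n)
    have "inf (real n *\<^sub>R x + x) y = 0"
      using Suc assms nonneg by (intro inf_add_eq_0) (auto intro: scaleR_nonneg_nonneg)
    then show ?case
      by (simp add: scaleR_add_left add.commute)
  qed (use nonneg in \<open>simp add: inf_absorb1\<close>)
  obtain n where "t \<le> real n"
    using real_arch_simple by blast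
  then have "t *\<^sub>R x \<le> real n *\<^sub>R x"
    using nonneg by (intro scaleR_right_mono)
  then have "inf (t *\<^sub>R x) y \<le> inf (real n *\<^sub>R x) y"
    by (intro inf_mono) auto
  moreover have "0 \<le> inf (t *\<^sub>R x) y"
    using nonneg assms(2) by (auto intro: scaleR_nonneg_nonneg)
  ultimately show ?thesis
    using nat by (metis antisym)
qed

text \<open>For the lower bound put p = |u| and q = |v|. Then p + q - inf (2 q) (2 p) = |p - q|,
  which is below |u + v| by the triangle inequality, and the infimum vanishes by
  disjointness.\<close>

lemma abs_add_disjoint:
  fixes u v :: "'a::banach_lattice"
  assumes "inf \<bar>u\<bar> \<bar>v\<bar> = 0"
  shows "\<bar>u + v\<bar> = \<bar>u\<bar> + \<bar>v\<bar>"
proof (rule antisym)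
  let ?p = "\<bar>u\<bar>" and ?q = "\<bar>v\<bar>"
  have two: "inf (?q + ?q) (?p + ?p) = 0"
  proof -
    have "inf (?p + ?p) ?q = 0"
      using assms by (intro inf_add_eq_0) auto
    then have "inf ?q (?p + ?p) = 0"
      by (simp add: inf_commute)
    then show ?thesis
      by (intro inf_add_eq_0) auto
  qed
  have "?p + ?q = (?p + ?q) - inf (?q + ?q) (?p + ?p)"
    by (simp add: two)
  also have "\<dots> = (?p + ?q) + sup (- (?q + ?q)) (- (?p + ?p))"
    by (simp add: neg_inf_eq_sup)
  also have "\<dots> = sup (?p + ?q + - (?q + ?q)) (?p + ?q + - (?p + ?p))"
    by (rule add_sup_distrib_left)
  also have "\<dots> = sup (?p - ?q) (- (?p - ?q))"
    by (simp add: algebra_simps)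
  also have "\<dots> = \<bar>?p - ?q\<bar>"
    by (rule abs_lattice[symmetric])
  also have "\<dots> \<le> \<bar>u + v\<bar>"
    using abs_triangle_ineq3[of u "- v"] by simp
  finally show "?p + ?q \<le> \<bar>u + v\<bar>" .
qed (rule abs_triangle_ineq)

lemma abs_scaleR_lattice:
  fixes x :: "'a::banach_lattice"
  assumes "0 \<le> x"
  shows "\<bar>a *\<^sub>R x\<bar> = \<bar>a\<bar> *\<^sub>R x"
proof (cases "0 \<le> a")
  case True
  then show ?thesis
    using assms by (simp add: scaleR_nonneg_nonneg)
next
  case False
  then have "\<bar>- (a *\<^sub>R x)\<bar> = (- a) *\<^sub>R x"
    using assms scaleR_nonneg_nonneg[of "- a" x] by (simp del: abs_minus_cancel)
  then show ?thesis
    using False by simp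
qed

lemma abs_sum_disjoint:
  fixes d :: "nat \<Rightarrow> 'a::banach_lattice"
  assumes "\<And>n. 0 \<le> d n" "\<And>n m. n \<noteq> m \<Longrightarrow> inf (d n) (d m) = 0"
  shows "\<bar>\<Sum>i<n. a i *\<^sub>R d i\<bar> = (\<Sum>i<n. \<bar>a i\<bar> *\<^sub>R d i)"
proof (induction n)
  case (Suc n)
  have disj: "inf (\<Sum>i<m. \<bar>a i\<bar> *\<^sub>R d i) (\<bar>a n\<bar> *\<^sub>R d n) = 0" if "m \<le> n" for m
    using that
  proof (induction m)
    case 0
    then show ?case
      using assms(1)[of n] by (simp add: inf_absorb1 scaleR_nonneg_nonneg)
  next
    case (Suc m)
    have "inf (\<bar>a n\<bar> *\<^sub>R d n) (d m) = 0"
      using assms(2)[of n m] Suc.prems by (intro inf_scaleR_eq_0) auto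
    then have "inf (\<bar>a m\<bar> *\<^sub>R d m) (\<bar>a n\<bar> *\<^sub>R d n) = 0"
      by (intro inf_scaleR_eq_0) (simp_all add: inf_commute)
    then show ?case
      unfolding sum.lessThan_Suc using Suc assms(1)
      by (intro inf_add_eq_0) (auto intro!: scaleR_nonneg_nonneg sum_nonneg)
  qed
  show ?case
    unfolding sum.lessThan_Suc
    by (subst abs_add_disjoint) (use disj[of n] Suc assms(1)[of n] in \<open>simp_all add: abs_scaleR_lattice\<close>)
qed simp

text \<open>On a disjoint sequence the modulus acts on the coefficients, so monotonicity of the
  lattice norm gives constant 1.\<close>

lemma unconditional_sequence_if_disjoint:
  fixes d :: "nat \<Rightarrow> 'a::banach_lattice"
  assumes d: "\<And>n. 0 < d n" "\<And>n m. n \<noteq> m \<Longrightarrow> inf (d n) (d m) = 0"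
  shows "unconditional_sequence d"
  unfolding unconditional_sequence_def
proof (intro conjI allI exI[of _ 1] impI)
  show "d n \<noteq> 0" for n
    using d(1)[of n] by auto
  fix n and a b :: "nat \<Rightarrow> real"
  assume ab: "\<forall>i. \<bar>b i\<bar> \<le> \<bar>a i\<bar>"
  have d0: "0 \<le> d n" for n
    using d(1)[of n] by simp
  have abs_eq: "\<bar>\<Sum>i<n. c i *\<^sub>R d i\<bar> = (\<Sum>i<n. \<bar>c i\<bar> *\<^sub>R d i)" for c
    by (rule abs_sum_disjoint) (use d0 d(2) in auto)
  have "\<bar>\<Sum>i<n. b i *\<^sub>R d i\<bar> \<le> \<bar>\<Sum>i<n. a i *\<^sub>R d i\<bar>"
    unfolding abs_eq using ab d0 by (intro sum_mono scaleR_right_mono) auto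
  then show "norm (\<Sum>i<n. b i *\<^sub>R d i) \<le> 1 * norm (\<Sum>i<n. a i *\<^sub>R d i)"
    using norm_mono_abs by simp
qed

section \<open>The Archimedean property and atoms\<close>

lemma eq_0_if_le_small:
  fixes x a :: "'a::banach_lattice"
  assumes "0 \<le> x" "0 \<le> a" "\<And>\<epsilon>. 0 < \<epsilon> \<Longrightarrow> \<epsilon> \<le> 1 \<Longrightarrow> x \<le> \<epsilon> *\<^sub>R a"
  shows "x = 0"
proof (rule ccontr)
  assume "x \<noteq> 0"
  have le: "norm x \<le> \<epsilon> * norm a" if "0 < \<epsilon>" "\<epsilon> \<le> 1" for \<epsilon>
    using norm_mono_abs[of x "\<epsilon> *\<^sub>R a"] assms that by (simp add: scaleR_nonneg_nonneg)
  \<comment> \<open>Chosen so that ?\<epsilon> * norm a is at most half of norm x; the summand 1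
    avoids a division by zero.\<close>
  let ?\<epsilon> = "min 1 (norm x / (2 * (norm a + 1)))"
  have "norm x \<le> ?\<epsilon> * norm a"
    using \<open>x \<noteq> 0\<close> by (intro le) (auto simp: add_nonneg_pos)
  also have "\<dots> \<le> norm x / (2 * (norm a + 1)) * norm a"
    by (intro mult_right_mono) auto
  also have "\<dots> \<le> norm x / 2"
  proof -
    have "0 < 2 + norm a * 2"
      by (simp add: add_pos_nonneg)
    then show ?thesis
      by (simp add: field_simps)
  qed
  finally show False
    using \<open>x \<noteq> 0\<close> by simp
qed

text \<open>Indecomposability is used in place of one-dimensionality of [0, a]: its failure supplies
  directly two nonzero disjoint elements below a.\<close>

definition atom :: "'a::banach_lattice \<Rightarrow> bool"
  where "atom a \<longleftrightarrow> 0 < a \<and>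
    (\<forall>y z. 0 \<le> y \<longrightarrow> y \<le> a \<longrightarrow> 0 \<le> z \<longrightarrow> z \<le> a \<longrightarrow> inf y z = 0 \<longrightarrow> y = 0 \<or> z = 0)"

text \<open>Let t be the largest number with t a \<le> x, and y the rest. For \<epsilon> > 0 the
  positive part r of \<epsilon> a - y is nonzero by maximality of t. It is disjoint from the
  positive part q of y - \<epsilon> a, so indecomposability of a makes q disjoint from a, and inf y
  a \<le> \<epsilon> a follows.\<close>

lemma atom_component:
  fixes a x :: "'a::banach_lattice"
  assumes a: "atom a" and x: "0 \<le> x"
  shows "\<exists>t\<ge>0. t *\<^sub>R a \<le> x \<and> inf (x - t *\<^sub>R a) a = 0"
proof -
  have a0: "0 \<le> a" "0 < norm a"
    using a by (auto simp: atom_def)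
  define A where "A = {t. t *\<^sub>R a \<le> x}"
  have "0 \<in> A"
    using x by (simp add: A_def)
  have bdd: "bdd_above A"
  proof (rule bdd_aboveI)
    fix t assume "t \<in> A"
    show "t \<le> norm x / norm a"
    proof (cases "0 \<le> t")
      case True
      then have "norm (t *\<^sub>R a) \<le> norm x"
        using \<open>t \<in> A\<close> a0 x by (intro norm_mono_abs) (simp add: A_def scaleR_nonneg_nonneg)
      then show ?thesis
        using True a0 by (simp add: field_simps)
    qed (use a0 in \<open>auto intro: order_trans[of _ 0]\<close>)
  qed
  define t where "t = Sup A"
  have "0 \<le> t"
    unfolding t_def by (rule cSup_upper[OF \<open>0 \<in> A\<close> bdd])
  \<comment> \<open>The supremum is attained, by the Archimedean property.\<close>
  have "sup (t *\<^sub>R a - x) 0 = 0"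
  proof (rule eq_0_if_le_small[OF _ a0(1)])
    fix \<epsilon> :: real
    assume \<epsilon>: "0 < \<epsilon>"
    then obtain s where s: "s \<in> A" "t - \<epsilon> < s"
      using less_cSupD[of A "t - \<epsilon>"] \<open>0 \<in> A\<close> by (auto simp: t_def)
    have "t *\<^sub>R a - x \<le> t *\<^sub>R a - s *\<^sub>R a"
      using s(1) by (intro diff_left_mono) (simp add: A_def)
    also have "\<dots> = (t - s) *\<^sub>R a"
      by (simp add: scaleR_diff_left)
    also have "\<dots> \<le> \<epsilon> *\<^sub>R a"
      using s a0 by (intro scaleR_right_mono) auto
    finally show "sup (t *\<^sub>R a - x) 0 \<le> \<epsilon> *\<^sub>R a"
      using \<epsilon> a0 by (simp add: scaleR_nonneg_nonneg)
  qed simp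
  then have tx: "t *\<^sub>R a \<le> x"
    by (metis diff_le_0_iff_le sup.cobounded1)
  define y where "y = x - t *\<^sub>R a"
  have y: "0 \<le> y"
    using tx by (simp add: y_def)
  have "inf y a = 0"
  proof (rule eq_0_if_le_small[OF _ a0(1)])
    show "0 \<le> inf y a"
      using y a0 by simp
    fix \<epsilon> :: real
    assume \<epsilon>: "0 < \<epsilon>" "\<epsilon> \<le> 1"
    define q where "q = sup (y - \<epsilon> *\<^sub>R a) 0"
    define r where "r = sup (\<epsilon> *\<^sub>R a - y) 0"
    have qr: "0 \<le> q" "0 \<le> r"
      by (simp_all add: q_def r_def)
    have "r \<noteq> 0"
    proof
      assume "r = 0"
      then have "\<epsilon> *\<^sub>R a \<le> y"
        unfolding r_def by (metis diff_le_0_iff_le sup.cobounded1)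
      then have "t + \<epsilon> \<in> A"
        by (simp add: A_def y_def scaleR_add_left algebra_simps)
      then have "t + \<epsilon> \<le> t"
        unfolding t_def by (rule cSup_upper[OF _ bdd])
      then show False
        using \<epsilon> by simp
    qed
    have "r \<le> \<epsilon> *\<^sub>R a"
      using y \<epsilon> a0 by (simp add: r_def scaleR_nonneg_nonneg)
    also have "\<dots> \<le> 1 *\<^sub>R a"
      using \<epsilon> a0 by (intro scaleR_right_mono) auto
    finally have "r \<le> a"
      by simp
    have rq: "r = q + (\<epsilon> *\<^sub>R a - y)"
      unfolding r_def q_def add_sup_distrib_right by (simp add: sup_commute)
    have "inf q r = inf (q + 0) (q + (\<epsilon> *\<^sub>R a - y))"
      by (simp add: rq)
    also have "\<dots> = q + inf 0 (\<epsilon> *\<^sub>R a - y)"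
      by (rule add_inf_distrib_left[symmetric])
    also have "inf 0 (\<epsilon> *\<^sub>R a - y) = - q"
      unfolding q_def neg_sup_eq_inf by (simp add: inf_commute)
    finally have "inf q r = 0"
      by simp
    then have "inf (inf q a) r = 0"
      using qr a0 by (metis inf.assoc inf.commute inf_absorb1)
    then have "inf q a = 0"
      using a \<open>r \<noteq> 0\<close> \<open>r \<le> a\<close> qr a0 unfolding atom_def by (metis inf.cobounded2 le_inf_iff)
    have "inf y a \<le> inf (q + \<epsilon> *\<^sub>R a) (a + \<epsilon> *\<^sub>R a)"
    proof (rule inf_mono)
      have "y - \<epsilon> *\<^sub>R a \<le> q"
        by (simp add: q_def)
      then show "y \<le> q + \<epsilon> *\<^sub>R a"
        by (simp add: algebra_simps)
      show "a \<le> a + \<epsilon> *\<^sub>R a"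
        using \<epsilon> a0 by (simp add: scaleR_nonneg_nonneg)
    qed
    also have "\<dots> = \<epsilon> *\<^sub>R a"
      using \<open>inf q a = 0\<close> by (simp flip: add_inf_distrib_right)
    finally show "inf y a \<le> \<epsilon> *\<^sub>R a" .
  qed
  then show ?thesis
    using \<open>0 \<le> t\<close> tx by (auto simp: y_def)
qed

text \<open>Components along the atoms are removed one at a time. The remainder only decreases, so
  disjointness from the atoms already treated is kept.\<close>

lemma ex_component_disjoint_from_atoms:
  fixes x :: "'a::banach_lattice"
  assumes "finite A" "\<And>a. a \<in> A \<Longrightarrow> atom a" "0 \<le> x"
  shows "\<exists>y\<ge>0. x - y \<in> span A \<and> (\<forall>a\<in>A. inf y a = 0)"
  using assms
proof (induction A rule: finite_induct)
  case empty
  then show ?case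
    by (intro exI[of _ x]) auto
next
  case (insert a A)
  then obtain y where y: "0 \<le> y" "x - y \<in> span A" "\<forall>a\<in>A. inf y a = 0"
    by auto
  have a: "0 \<le> a"
    using insert.prems(1)[of a] by (simp add: atom_def less_imp_le)
  obtain t where t: "0 \<le> t" "t *\<^sub>R a \<le> y" "inf (y - t *\<^sub>R a) a = 0"
    using atom_component[OF _ y(1), of a] insert.prems(1) by auto
  have disj: "inf (y - t *\<^sub>R a) b = 0" if "b \<in> A" for b
  proof (rule antisym)
    have "0 \<le> b"
      using insert.prems(1)[of b] that by (simp add: atom_def less_imp_le)
    then show "0 \<le> inf (y - t *\<^sub>R a) b"
      using t(2) by simp
    have "y - t *\<^sub>R a \<le> y"
      using t(1) a by (simp add: scaleR_nonneg_nonneg)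
    then have "inf (y - t *\<^sub>R a) b \<le> inf y b"
      by (intro inf_mono) auto
    then show "inf (y - t *\<^sub>R a) b \<le> 0"
      using y(3) that by simp
  qed
  have "x - (y - t *\<^sub>R a) = (x - y) + t *\<^sub>R a"
    by simp
  moreover have "x - y \<in> span (insert a A)" "t *\<^sub>R a \<in> span (insert a A)"
    using y(2) span_mono[of A "insert a A"] by (auto intro: span_scale span_base)
  ultimately have "x - (y - t *\<^sub>R a) \<in> span (insert a A)"
    by (simp only: span_add)
  with t disj show ?case
    by (intro exI[of _ "y - t *\<^sub>R a"]) auto
qed

text \<open>The recursion carries a pair: a piece that is kept, and a remainder disjoint from it
  that is split further.\<close>

lemma ex_disjoint_sequence_if_no_atoms:
  fixes x :: "'a::banach_lattice"
  assumes "0 < x" "\<And>a. a \<le> x \<Longrightarrow> \<not> atom a"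
  shows "\<exists>d :: nat \<Rightarrow> 'a. (\<forall>n. 0 < d n) \<and> (\<forall>n m. n \<noteq> m \<longrightarrow> inf (d n) (d m) = 0)"
proof -
  have split: "\<exists>y' z'. 0 < y' \<and> 0 < z' \<and> y' \<le> z \<and> z' \<le> z \<and> inf y' z' = 0" if "0 < z" "z \<le> x" for z
    using assms(2)[OF that(2)] that(1) unfolding atom_def by (metis order.not_eq_order_implies_strict)
  let ?P = "\<lambda>n yz. 0 < fst yz \<and> 0 < snd yz \<and> snd yz \<le> x \<and> inf (fst yz) (snd yz) = 0"
  let ?Q = "\<lambda>n yz yz'. fst yz' \<le> snd yz \<and> snd yz' \<le> snd yz"
  have "\<exists>f. \<forall>n. ?P n (f n) \<and> ?Q n (f n) (f (Suc n))"
  proof (rule dependent_nat_choice)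
    show "\<exists>yz. ?P 0 yz"
      using split[OF assms(1) order_refl] by auto
    show "\<exists>yz'. ?P (Suc n) yz' \<and> ?Q n yz yz'" if "?P n yz" for yz n
      using split[of "snd yz"] that by (auto intro: order_trans)
  qed
  then obtain f where f: "\<And>n. ?P n (f n)" "\<And>n. ?Q n (f n) (f (Suc n))"
    by auto
  let ?d = "\<lambda>n. fst (f n)"
  have anti: "snd (f m) \<le> snd (f n)" if "n \<le> m" for n m
    using lift_Suc_antimono_le[of "\<lambda>n. snd (f n)"] f(2) that by blast
  have lt: "inf (?d n) (?d m) = 0" if less: "n < m" for n m
  proof (rule antisym)
    obtain k where k: "m = Suc k" "n \<le> k"
      using less by (cases m) (auto simp: less_Suc_eq_le)
    have "?d m \<le> snd (f n)"
      using f(2)[of k] anti[OF k(2)] k(1) by auto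
    then have "inf (?d n) (?d m) \<le> inf (?d n) (snd (f n))"
      by (intro inf_mono) auto
    then show "inf (?d n) (?d m) \<le> 0"
      using f(1)[of n] by simp
    show "0 \<le> inf (?d n) (?d m)"
      using f(1)[of n] f(1)[of m] by (simp add: less_imp_le)
  qed
  have "inf (?d n) (?d m) = 0" if "n \<noteq> m" for n m
    using lt[of n m] lt[of m n] that by (cases "n < m") (auto simp: inf_commute)
  then show ?thesis
    using f(1) by (intro exI[of _ ?d]) auto
qed

text \<open>Either some positive element has no atom below it and can be split forever, or every
  positive element lies above an atom. In the second case disjoint atoms are chosen greedily: if a
  finite set of atoms could not be extended, all remainders after removing components would vanish
  and the set would span the lattice.\<close>

lemma ex_disjoint_sequence:
  assumes "\<nexists>B :: 'a::banach_lattice set. finite B \<and> span B = UNIV"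
  shows "\<exists>d :: nat \<Rightarrow> 'a. (\<forall>n. 0 < d n) \<and> (\<forall>n m. n \<noteq> m \<longrightarrow> inf (d n) (d m) = 0)"
proof (cases "\<exists>x>0 :: 'a. \<forall>a\<le>x. \<not> atom a")
  case True
  then show ?thesis
    using ex_disjoint_sequence_if_no_atoms by blast
next
  case False
  have ex: "\<exists>a. atom a \<and> (\<forall>b\<in>A. inf b a = 0)" if A: "finite A" "\<And>a. a \<in> A \<Longrightarrow> atom (a :: 'a)" for A
  proof (rule ccontr)
    assume *: "\<not> ?thesis"
    have nonneg: "x \<in> span A" if "0 \<le> x" for x
    proof -
      obtain y where y: "0 \<le> y" "x - y \<in> span A" "\<forall>a\<in>A. inf y a = 0"
        using ex_component_disjoint_from_atoms[OF A \<open>0 \<le> x\<close>] by auto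
      have "y = 0"
      proof (rule ccontr)
        assume "y \<noteq> 0"
        then obtain a where a: "atom a" "a \<le> y"
          using False y(1) by (metis order.not_eq_order_implies_strict)
        have "inf b a = 0" if "b \<in> A" for b
        proof (rule antisym)
          have "inf b a \<le> inf y b"
            using a(2) by (simp add: le_infI2)
          then show "inf b a \<le> 0"
            using y(3) that by simp
          show "0 \<le> inf b a"
            using A(2)[OF that] a(1) by (simp add: atom_def less_imp_le)
        qed
        with a(1) * show False
          by blast
      qed
      with y(2) show ?thesis
        by simp
    qed
    have "x \<in> span A" for x
    proof -
      have "pprt x \<in> span A" "- nprt x \<in> span A"
        by (auto intro!: nonneg)
      then have "pprt x - - nprt x \<in> span A"
        by (rule span_diff)
      then show ?thesis
        by (simp flip: prts)
    qed
    with A(1) assms show False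
      by blast
  qed
  let ?Q = "\<lambda>f n a. atom (a :: 'a) \<and> (\<forall>k<n. inf (f k) a = 0)"
  have "\<exists>d :: nat \<Rightarrow> 'a. \<forall>n. ?Q d n (d n)"
  proof (rule dependent_wellorder_choice)
    fix n :: nat and f :: "nat \<Rightarrow> 'a"
    assume "\<And>k. k < n \<Longrightarrow> ?Q f k (f k)"
    then have "\<exists>a. atom a \<and> (\<forall>b\<in>f ` {..<n}. inf b a = 0)"
      by (intro ex) auto
    then show "\<exists>a. ?Q f n a"
      by auto
  qed auto
  then obtain d :: "nat \<Rightarrow> 'a" where d: "\<And>n. atom (d n)" "\<And>k n. k < n \<Longrightarrow> inf (d k) (d n) = 0"
    by blast
  have "inf (d n) (d m) = 0" if "n \<noteq> m" for n m
    using d(2)[of n m] d(2)[of m n] that by (cases "n < m") (auto simp: inf_commute)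
  then show ?thesis
    using d(1) by (intro exI[of _ d]) (auto simp: atom_def)
qed

section \<open>Unconditional bases\<close>

text \<open>Convexity, one coordinate at a time: a point of the cube is an average of vertices. The
  translation v is there for the induction.\<close>

lemma norm_add_sum_scaleR_le:
  fixes x :: "nat \<Rightarrow> 'a::real_normed_vector"
  assumes "finite F" "\<And>i. 0 \<le> t i" "\<And>i. t i \<le> 1"
    and "\<And>G. G \<subseteq> F \<Longrightarrow> norm (v + (\<Sum>i\<in>G. x i)) \<le> R"
  shows "norm (v + (\<Sum>i\<in>F. t i *\<^sub>R x i)) \<le> R"
  using assms(1,4)
proof (induction F arbitrary: v rule: finite_induct)
  case (insert j F)
  have "norm (v + t j *\<^sub>R x j + (\<Sum>i\<in>F. t i *\<^sub>R x i)) \<le> R"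
  proof (rule insert.IH)
    fix G assume G: "G \<subseteq> F"
    then have "finite G" "j \<notin> G"
      using insert finite_subset by auto
    let ?s = "\<Sum>i\<in>G. x i"
    have "norm (v + ?s) \<le> R"
      using insert.prems[of G] G by auto
    moreover have "norm (v + (x j + ?s)) \<le> R"
      using insert.prems[of "insert j G"] G \<open>finite G\<close> \<open>j \<notin> G\<close> by auto
    moreover have "v + t j *\<^sub>R x j + ?s = (1 - t j) *\<^sub>R (v + ?s) + t j *\<^sub>R (v + (x j + ?s))"
      by (simp add: algebra_simps)
    then have "norm (v + t j *\<^sub>R x j + ?s) \<le> (1 - t j) * norm (v + ?s) + t j * norm (v + (x j + ?s))"
      using norm_triangle_ineq[of "(1 - t j) *\<^sub>R (v + ?s)" "t j *\<^sub>R (v + (x j + ?s))"] assms(2,3)[of j]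
      by simp
    ultimately have "norm (v + t j *\<^sub>R x j + ?s) \<le> (1 - t j) * R + t j * R"
      using assms(2,3)[of j] by (smt (verit) mult_left_mono)
    then show "norm (v + t j *\<^sub>R x j + ?s) \<le> R"
      by (simp add: algebra_simps)
  qed
  then show ?case
    using insert by (simp add: add.assoc)
qed simp

text \<open>The positive and the negative part of the ratio b i / a i both have values in [0, 1].
  Each costs K, hence the constant 2 * K.\<close>

lemma unconditional_sequence_if_subset_bounded:
  fixes e :: "nat \<Rightarrow> 'a::real_normed_vector"
  assumes "\<And>n. e n \<noteq> 0"
    and K: "\<And>n a G. G \<subseteq> {..<n} \<Longrightarrow> norm (\<Sum>i\<in>G. a i *\<^sub>R e i) \<le> K * norm (\<Sum>i<n. a i *\<^sub>R e i)"
  shows "unconditional_sequence e"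
  unfolding unconditional_sequence_def
proof (intro conjI allI exI[of _ "2 * K"] impI)
  fix n and a b :: "nat \<Rightarrow> real"
  assume ab: "\<forall>i. \<bar>b i\<bar> \<le> \<bar>a i\<bar>"
  \<comment> \<open>Where a i = 0 the quotient is 0, as it should be, since b i = 0 there
    too.\<close>
  define t where "t i = b i / a i" for i
  let ?R = "K * norm (\<Sum>i<n. a i *\<^sub>R e i)"
  have t: "b i = t i * a i" "\<bar>t i\<bar> \<le> 1" for i
    using spec[OF ab, of i] by (auto simp: t_def divide_le_eq)
  have part: "norm (0 + (\<Sum>i<n. u i *\<^sub>R (a i *\<^sub>R e i))) \<le> ?R" if "\<And>i. 0 \<le> u i" "\<And>i. u i \<le> 1" for u
    by (rule norm_add_sum_scaleR_le) (use that K in auto)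
  have "(\<Sum>i<n. b i *\<^sub>R e i)
      = (\<Sum>i<n. max 0 (t i) *\<^sub>R (a i *\<^sub>R e i)) - (\<Sum>i<n. max 0 (- t i) *\<^sub>R (a i *\<^sub>R e i))"
    unfolding sum_subtractf[symmetric] t(1) by (rule sum.cong) (auto simp: max_def)
  also have "norm \<dots> \<le> ?R + ?R"
    by (rule order_trans[OF norm_triangle_ineq4])
      (use part[of "\<lambda>i. max 0 (t i)"] part[of "\<lambda>i. max 0 (- t i)"] t(2) in \<open>auto simp: abs_le_iff\<close>)
  finally show "norm (\<Sum>i<n. b i *\<^sub>R e i) \<le> 2 * K * norm (\<Sum>i<n. a i *\<^sub>R e i)"
    by simp
qed (rule assms(1))

text \<open>Real and complex scalars are treated together. \<open>basis\<close> speaks of existence,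
  uniqueness and unconditional convergence of expansions; a uniform bound has to be extracted from
  completeness of Y.\<close>

locale closed_unconditional_basis =
  fixes s :: "'k::{real_normed_field, banach} \<Rightarrow> 'a::banach \<Rightarrow> 'a" and e :: "nat \<Rightarrow> 'a" and Y :: "'a set"
  assumes vector_space: "vector_space s"
    and norm_s: "norm (s r x) = norm r * norm x"
    and s_of_real: "s (of_real \<rho>) x = \<rho> *\<^sub>R x"
    and subspace_s: "module.subspace s Y"
    and closed: "closed Y"
    and basis: "unconditional_basis s e Y"
begin

interpretation vector_space s
  by (rule vector_space)

lemma add_mem: "y \<in> Y \<Longrightarrow> z \<in> Y \<Longrightarrow> y + z \<in> Y"
  using subspace_s by (rule subspace_add)

lemma scaleR_mem: "y \<in> Y \<Longrightarrow> \<rho> *\<^sub>R y \<in> Y"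
  using subspace_scale[OF subspace_s, of y "of_real \<rho>"] by (simp add: s_of_real)

lemma zero_mem: "0 \<in> Y"
  using subspace_s by (rule subspace_0)

lemma diff_mem: "y \<in> Y \<Longrightarrow> z \<in> Y \<Longrightarrow> y - z \<in> Y"
  using subspace_s by (rule subspace_diff)

lemma s_scaleR_left: "s (\<rho> *\<^sub>R r) x = \<rho> *\<^sub>R s r x"
  unfolding scaleR_conv_of_real[of \<rho> r] scale_scale[symmetric] s_of_real ..

lemma bounded_linear_s: "bounded_linear (\<lambda>r. s r x)"
  by (rule bounded_linear_intro[of _ "norm x"])
    (simp_all add: scale_left_distrib s_scaleR_left norm_s)

section \<open>Coefficients of expansions\<close>

definition coeff :: "'a \<Rightarrow> nat \<Rightarrow> 'k"
  where "coeff y = (THE a. (\<lambda>n. s (a n) (e n)) sums y)"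

lemma ex1_coeff: "y \<in> Y \<Longrightarrow> \<exists>!a. (\<lambda>n. s (a n) (e n)) sums y"
  using basis unfolding unconditional_basis_def by simp

lemma coeff_sums: "y \<in> Y \<Longrightarrow> (\<lambda>n. s (coeff y n) (e n)) sums y"
  unfolding coeff_def by (rule theI'[OF ex1_coeff])

lemma coeff_eqI: "y \<in> Y \<Longrightarrow> (\<lambda>n. s (a n) (e n)) sums y \<Longrightarrow> coeff y = a"
  unfolding coeff_def by (rule the1_equality[OF ex1_coeff])

lemma coeff_add:
  assumes "y \<in> Y" "z \<in> Y"
  shows "coeff (y + z) = (\<lambda>i. coeff y i + coeff z i)"
  using sums_add[OF coeff_sums[OF assms(1)] coeff_sums[OF assms(2)]] assms
  by (intro coeff_eqI) (simp_all add: add_mem scale_left_distrib)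

lemma coeff_scaleR:
  assumes "y \<in> Y"
  shows "coeff (\<rho> *\<^sub>R y) = (\<lambda>i. \<rho> *\<^sub>R coeff y i)"
  using sums_scaleR_right[OF coeff_sums[OF assms], of \<rho>] assms
  by (intro coeff_eqI) (simp_all add: scaleR_mem s_scaleR_left)

lemma coeff_finite_sum: "coeff (\<Sum>i<n. s (a i) (e i)) = (\<lambda>i. if i < n then a i else 0)"
proof (rule coeff_eqI)
  show "(\<Sum>i<n. s (a i) (e i)) \<in> Y"
    using basis subspace_s unfolding unconditional_basis_def
    by (intro subspace_sum subspace_scale) auto
  have "(\<lambda>i. if i < n then s (a i) (e i) else 0) sums (\<Sum>i<n. s (a i) (e i))"
    using sums_If_finite[of "\<lambda>i. i < n" "\<lambda>i. s (a i) (e i)"] by (simp add: lessThan_def)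
  then show "(\<lambda>i. s (if i < n then a i else 0) (e i)) sums (\<Sum>i<n. s (a i) (e i))"
    by (rule sums_cong[THEN iffD1, rotated]) simp
qed

lemma e_neq_0: "e n \<noteq> 0"
proof
  assume "e n = 0"
  have "(\<lambda>i. s (0 :: 'k) (e i)) sums 0"
    by simp
  then have "coeff 0 = (\<lambda>_. 0)"
    by (rule coeff_eqI[OF zero_mem])
  moreover have "(\<lambda>i. s (if i = n then 1 else 0 :: 'k) (e i)) = (\<lambda>_. 0)"
    using \<open>e n = 0\<close> by auto
  then have "coeff 0 = (\<lambda>i. if i = n then 1 else 0)"
    by (intro coeff_eqI[OF zero_mem]) (simp only: sums_zero)
  ultimately show False
    by (metis zero_neq_one)
qed

text \<open>The least such M is a norm of y that dominates the given one. The aim is to show that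
  the two are equivalent, by the proof of the open mapping theorem without setting up a second
  Banach space.\<close>

definition partial_sums_le :: "real \<Rightarrow> 'a \<Rightarrow> bool"
  where "partial_sums_le M y \<longleftrightarrow> (\<forall>F. finite F \<longrightarrow> norm (\<Sum>i\<in>F. s (coeff y i) (e i)) \<le> M)"

lemma partial_sums_le_diff:
  assumes "y \<in> Y" "z \<in> Y" "partial_sums_le M y" "partial_sums_le N z"
  shows "partial_sums_le (M + N) (y - z)"
  unfolding partial_sums_le_def
proof (intro allI impI)
  fix F :: "nat set" assume "finite F"
  have "coeff (y - z) = (\<lambda>i. coeff y i - coeff z i)"
    using coeff_add[OF assms(1) scaleR_mem[OF assms(2)], of "- 1"] coeff_scaleR[OF assms(2), of "- 1"] by simp
  then have "(\<Sum>i\<in>F. s (coeff (y - z) i) (e i)) = (\<Sum>i\<in>F. s (coeff y i) (e i)) - (\<Sum>i\<in>F. s (coeff z i) (e i))"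
    by (simp add: scale_left_diff_distrib sum_subtractf)
  then have "norm (\<Sum>i\<in>F. s (coeff (y - z) i) (e i))
      \<le> norm (\<Sum>i\<in>F. s (coeff y i) (e i)) + norm (\<Sum>i\<in>F. s (coeff z i) (e i))"
    by (simp only: norm_triangle_ineq4)
  moreover have "norm (\<Sum>i\<in>F. s (coeff y i) (e i)) \<le> M" "norm (\<Sum>i\<in>F. s (coeff z i) (e i)) \<le> N"
    using assms(3,4) \<open>finite F\<close> by (auto simp: partial_sums_le_def)
  ultimately show "norm (\<Sum>i\<in>F. s (coeff (y - z) i) (e i)) \<le> M + N"
    by linarith
qed

lemma partial_sums_le_scaleR:
  assumes "y \<in> Y" "partial_sums_le M y"
  shows "partial_sums_le (\<bar>\<rho>\<bar> * M) (\<rho> *\<^sub>R y)"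
  using assms(2) unfolding partial_sums_le_def coeff_scaleR[OF assms(1)] s_scaleR_left
    scaleR_sum_right[symmetric] norm_scaleR
  by (intro allI impI mult_left_mono) auto

text \<open>Unconditional convergence gives F0 such that sums over larger finite sets stay within 1
  of y. The sum over any F is the one over F \<union> F0 less a sum over a part of F0.\<close>

lemma ex_partial_sums_le:
  assumes "y \<in> Y"
  shows "\<exists>M. partial_sums_le M y"
proof -
  let ?f = "\<lambda>i. s (coeff y i) (e i)"
  have "(?f has_sum y) UNIV"
    using basis coeff_sums[OF assms] assms unfolding unconditional_basis_def by blast
  then have "\<forall>\<^sub>F F in finite_subsets_at_top UNIV. dist (sum ?f F) y < 1"
    unfolding has_sum_def by (rule tendstoD) simp
  then obtain F0 where F0: "finite F0" "\<And>F. finite F \<Longrightarrow> F0 \<subseteq> F \<Longrightarrow> dist (sum ?f F) y < 1"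
    unfolding eventually_finite_subsets_at_top by auto
  have "norm (sum ?f F) \<le> norm y + 1 + (\<Sum>i\<in>F0. norm (?f i))" if "finite F" for F
  proof -
    have "sum ?f (F \<union> F0) = sum ?f F + sum ?f (F0 - F)"
      using sum.union_disjoint[of F "F0 - F" ?f] that F0(1) by (simp add: Un_Diff_cancel)
    then have "norm (sum ?f F) \<le> norm (sum ?f (F \<union> F0)) + norm (sum ?f (F0 - F))"
      by (metis add_diff_cancel_right' norm_triangle_ineq4)
    moreover have "norm (sum ?f (F \<union> F0)) \<le> norm y + 1"
      using F0(2)[of "F \<union> F0"] F0(1) that norm_triangle_sub[of "sum ?f (F \<union> F0)" y]
      by (simp add: dist_norm)
    moreover have "norm (sum ?f (F0 - F)) \<le> (\<Sum>i\<in>F0. norm (?f i))"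
      by (rule order_trans[OF norm_sum]) (use F0(1) in \<open>auto intro: sum_mono2\<close>)
    ultimately show ?thesis
      by simp
  qed
  then show ?thesis
    unfolding partial_sums_le_def by blast
qed

text \<open>The first half of the open mapping theorem, by Baire category.\<close>

lemma ex_approximation:
  obtains M where "0 \<le> M"
    "\<And>y \<delta>. y \<in> Y \<Longrightarrow> 0 < \<delta> \<Longrightarrow> \<exists>z\<in>Y. partial_sums_le (M * norm y) z \<and> norm (y - z) \<le> \<delta>"
proof -
  define A where "A n = {y \<in> Y. partial_sums_le (real n) y}" for n
  define \<G> where "\<G> = range (\<lambda>n. Y \<inter> closure (A n))"
  have "y \<in> \<Union>\<G>" if y: "y \<in> Y" for y
  proof -
    obtain M n where "partial_sums_le M y" "M \<le> real n"
      using ex_partial_sums_le[OF y] real_arch_simple by blast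
    then have "y \<in> A n"
      using y by (auto simp: A_def partial_sums_le_def intro: order_trans)
    then show ?thesis
      using y closure_subset by (auto simp: \<G>_def)
  qed
  then have "\<Union>\<G> = Y"
    by (auto simp: \<G>_def)
  have "completely_metrizable_space (top_of_set Y)"
    using closed by (simp add: completely_metrizable_space_closedin completely_metrizable_space_euclidean)
  then have "\<exists>T\<in>\<G>. \<not> (closedin (top_of_set Y) T \<and> top_of_set Y interior_of T = {})"
    using Baire_category_alt[of "top_of_set Y" \<G>] zero_mem \<open>\<Union>\<G> = Y\<close>
    by (auto simp: \<G>_def interior_of_topspace[of "top_of_set Y", simplified])
  then obtain n where "top_of_set Y interior_of (Y \<inter> closure (A n)) \<noteq> {}"
    by (auto simp: \<G>_def closedin_closed_Int)
  then obtain U y0 where U: "openin (top_of_set Y) U" "y0 \<in> U" "U \<subseteq> Y \<inter> closure (A n)"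
    by (auto simp: interior_of_def)
  then obtain r where r: "0 < r" "ball y0 r \<inter> Y \<subseteq> U"
    by (auto simp: openin_contains_ball)
  have y0: "y0 \<in> Y" "y0 \<in> closure (A n)"
    using U by auto
  \<comment> \<open>Differences of approximants of y0 + y and of y0 move the ball from y0 to 0 and
    double the bound n.\<close>
  have small: "\<exists>z\<in>Y. partial_sums_le (2 * real n) z \<and> norm (y - z) \<le> \<delta>"
    if "y \<in> Y" "norm y < r" and \<delta>: "0 < \<delta>" for y \<delta>
  proof -
    have "y0 + y \<in> ball y0 r \<inter> Y"
      using that(1,2) y0 by (simp add: add_mem dist_norm)
    then have "y0 + y \<in> closure (A n)"
      using r(2) U(3) by blast
    then obtain a where a: "a \<in> A n" "dist a (y0 + y) < \<delta> / 2"
      using \<delta> unfolding closure_approachable by (meson half_gt_zero)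
    obtain b where b: "b \<in> A n" "dist b y0 < \<delta> / 2"
      using \<delta> y0(2) unfolding closure_approachable by (meson half_gt_zero)
    have "partial_sums_le (real n + real n) (a - b)" "a - b \<in> Y"
      using partial_sums_le_diff[of a b "real n" "real n"] a b by (auto simp: A_def diff_mem)
    moreover have "norm (y - (a - b)) \<le> \<delta>"
    proof -
      have "y - (a - b) = (b - y0) - (a - (y0 + y))"
        by simp
      also have "norm \<dots> \<le> norm (b - y0) + norm (a - (y0 + y))"
        by (rule norm_triangle_ineq4)
      also have "\<dots> \<le> \<delta>"
        using a(2) b(2) by (simp add: dist_norm)
      finally show ?thesis .
    qed
    ultimately show ?thesis
      by (intro bexI[of _ "a - b"]) auto
  qed
  show thesis
  proof (rule that)
    let ?M = "2 * real n * (2 / r)"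
    show "0 \<le> ?M"
      using r by simp
    fix y and \<delta> :: real
    assume y: "y \<in> Y" and \<delta>: "0 < \<delta>"
    show "\<exists>z\<in>Y. partial_sums_le (?M * norm y) z \<and> norm (y - z) \<le> \<delta>"
    proof (cases "y = 0")
      case True
      have "partial_sums_le 0 0"
        using coeff_scaleR[OF zero_mem, of 0] by (simp add: partial_sums_le_def)
      then show ?thesis
        using True \<delta> zero_mem by (intro bexI[of _ 0]) auto
    next
      case False
      \<comment> \<open>Scales y to norm r / 2, strictly inside the ball.\<close>
      define \<rho> where "\<rho> = 2 / r * norm y"
      have \<rho>: "0 < \<rho>"
        using r False by (simp add: \<rho>_def)
      have "norm (inverse \<rho> *\<^sub>R y) < r"
        using r False by (simp add: \<rho>_def field_simps)
      then obtain z where z: "z \<in> Y" "partial_sums_le (2 * real n) z" "norm (inverse \<rho> *\<^sub>R y - z) \<le> \<delta> / \<rho>"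
        using small[of "inverse \<rho> *\<^sub>R y" "\<delta> / \<rho>"] y \<delta> \<rho> scaleR_mem by auto
      have "y - \<rho> *\<^sub>R z = \<rho> *\<^sub>R (inverse \<rho> *\<^sub>R y - z)"
        using \<rho> by (simp add: scaleR_diff_right)
      then have "norm (y - \<rho> *\<^sub>R z) \<le> \<delta>"
        using z(3) \<rho> by (simp add: pos_le_divide_eq mult.commute)
      moreover have "partial_sums_le (?M * norm y) (\<rho> *\<^sub>R z)"
        using partial_sums_le_scaleR[OF z(1,2), of \<rho>] r(1) by (simp add: \<rho>_def mult_ac)
      ultimately show ?thesis
        using scaleR_mem[OF z(1)] by blast
    qed
  qed
qed

text \<open>The errors are approximated in turn with halved tolerances, so y is a series of terms z
  k whose bounds add up to 2 M norm y. Summing their coefficients gives a candidate expansion of y,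
  and uniqueness identifies it with \<open>coeff y\<close>.\<close>

lemma ex_partial_sums_le_mult_norm: "\<exists>K. \<forall>y\<in>Y. partial_sums_le (K * norm y) y"
proof -
  obtain M where M: "0 \<le> M" and approx:
      "\<And>y \<delta>. y \<in> Y \<Longrightarrow> 0 < \<delta> \<Longrightarrow> \<exists>z\<in>Y. partial_sums_le (M * norm y) z \<and> norm (y - z) \<le> \<delta>"
    by (rule ex_approximation) blast
  have "partial_sums_le (M * norm y * 2) y" if y: "y \<in> Y" "y \<noteq> 0" for y
  proof -
    define \<epsilon> where "\<epsilon> k = norm y * (1/2) ^ k" for k :: nat
    have \<epsilon>: "0 < \<epsilon> k" for k
      using y by (simp add: \<epsilon>_def)
    let ?P = "\<lambda>k v. v \<in> Y \<and> norm v \<le> \<epsilon> k \<and> (k = 0 \<longrightarrow> v = y)"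
    let ?Q = "\<lambda>k v v'. partial_sums_le (M * \<epsilon> k) (v - v')"
    have "\<exists>v. \<forall>k. ?P k (v k) \<and> ?Q k (v k) (v (Suc k))"
    proof (rule dependent_nat_choice)
      show "\<exists>v. ?P 0 v"
        using y by (simp add: \<epsilon>_def)
      fix v k assume v: "?P k v"
      obtain z where z: "z \<in> Y" "partial_sums_le (M * norm v) z" "norm (v - z) \<le> \<epsilon> (Suc k)"
        using approx[OF _ \<epsilon>] v by blast
      have "M * norm v \<le> M * \<epsilon> k"
        using v M by (intro mult_left_mono) auto
      then have "partial_sums_le (M * \<epsilon> k) z"
        using z(2) by (auto simp: partial_sums_le_def intro: order_trans)
      then show "\<exists>v'. ?P (Suc k) v' \<and> ?Q k v v'"
        using v z diff_mem by (intro exI[of _ "v - z"]) auto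
    qed
    then obtain v where v: "\<And>k. v k \<in> Y" "\<And>k. norm (v k) \<le> \<epsilon> k" "v 0 = y"
        "\<And>k. partial_sums_le (M * \<epsilon> k) (v k - v (Suc k))"
      by metis
    define z where "z k = v k - v (Suc k)" for k
    have z: "z k \<in> Y" "partial_sums_le (M * \<epsilon> k) (z k)" for k
      using v by (auto simp: z_def diff_mem)
    have \<epsilon>_sums: "(\<lambda>k. M * \<epsilon> k) sums (M * norm y * 2)"
      using sums_mult[OF geometric_sums[of "1/2 :: real"], of "M * norm y"] by (simp add: \<epsilon>_def mult_ac)
    then have \<epsilon>_summable: "summable (\<lambda>k. M * \<epsilon> k)"
      by (rule sums_summable)
    have "v \<longlonglongrightarrow> 0"
    proof (rule Lim_null_comparison)
      show "\<forall>\<^sub>F k in sequentially. norm (v k) \<le> \<epsilon> k"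
        using v(2) by simp
      show "\<epsilon> \<longlonglongrightarrow> 0"
        unfolding \<epsilon>_def by (intro tendsto_mult_right_zero LIMSEQ_power_zero) simp
    qed
    then have z_sums: "z sums y"
      using telescope_sums'[of v 0] v(3) by (simp add: z_def[abs_def])
    \<comment> \<open>A partial sum with one term controls a single coefficient, so the coefficients
      of the z k are summable over k.\<close>
    have norm_coeff: "norm (coeff (z k) i) \<le> M * \<epsilon> k / norm (e i)" for k i
    proof -
      have "norm (\<Sum>j\<in>{i}. s (coeff (z k) j) (e j)) \<le> M * \<epsilon> k"
        using z(2)[of k, unfolded partial_sums_le_def, rule_format, of "{i}"] by simp
      then show ?thesis
        using e_neq_0[of i] by (simp add: norm_s pos_le_divide_eq)
    qed
    have coeff_summable: "summable (\<lambda>k. coeff (z k) i)" for i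
      by (rule summable_comparison_test'[OF summable_divide[OF \<epsilon>_summable]]) (rule norm_coeff)
    define a where "a i = (\<Sum>k. coeff (z k) i)" for i
    have fin_sums: "(\<lambda>k. \<Sum>i\<in>F. s (coeff (z k) i) (e i)) sums (\<Sum>i\<in>F. s (a i) (e i))" for F
      unfolding a_def using coeff_summable
      by (intro sums_sum bounded_linear.sums[OF bounded_linear_s] summable_sums)
    have bound: "norm (\<Sum>i\<in>F. s (a i) (e i)) \<le> M * norm y * 2" if "finite F" for F
      using fin_sums \<epsilon>_sums
      by (rule norm_sums_le) (use z(2) that in \<open>auto simp: partial_sums_le_def\<close>)
    have "(\<lambda>n. s (a n) (e n)) sums y"
    proof -
      \<comment> \<open>The truncation error of the expansion of z k. It tends to 0 for each k and
        is dominated by the summable (M + 2) * \<epsilon> k, so Tannery's theorem exchanges the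
        limit in n with the sum over k.\<close>
      define h where "h k n = norm ((\<Sum>i<n. s (coeff (z k) i) (e i)) - z k)" for k n
      have h_le: "h k n \<le> M * \<epsilon> k + norm (z k)" for k n
      proof -
        have "h k n \<le> norm (\<Sum>i<n. s (coeff (z k) i) (e i)) + norm (z k)"
          unfolding h_def by (rule norm_triangle_ineq4)
        then show ?thesis
          using z(2)[of k] unfolding partial_sums_le_def by (smt (verit) finite_lessThan)
      qed
      have norm_z: "norm (z k) \<le> 2 * \<epsilon> k" for k
        unfolding z_def using norm_triangle_ineq4[of "v k" "v (Suc k)"] v(2)[of k] v(2)[of "Suc k"] \<epsilon>[of k]
        by (simp add: \<epsilon>_def)
      have "summable (\<lambda>k. (M + 2) * \<epsilon> k)"
        unfolding \<epsilon>_def by (intro summable_mult summable_geometric) simp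
      moreover have "norm (h k n) \<le> (M + 2) * \<epsilon> k" for k n
        using h_le[of k n] norm_z[of k] by (simp add: h_def distrib_right)
      moreover have h_lim: "h k \<longlonglongrightarrow> 0" for k
        unfolding h_def using coeff_sums[OF z(1)[of k]] unfolding sums_def
        by (intro tendsto_norm_zero) (simp add: LIM_zero_iff)
      ultimately have "eventually (\<lambda>n. summable (\<lambda>k. norm (h k n))) sequentially \<and>
          summable (\<lambda>k. norm (0 :: real)) \<and> ((\<lambda>n. \<Sum>k. h k n) \<longlonglongrightarrow> (\<Sum>k. 0))"
        by (intro tannerys_theorem[where M = "\<lambda>k. (M + 2) * \<epsilon> k"]) (auto simp: case_prod_unfold)
      then have lim: "(\<lambda>n. \<Sum>k. h k n) \<longlonglongrightarrow> 0"
          and summable_h: "\<forall>\<^sub>F n in sequentially. summable (\<lambda>k. norm (h k n))"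
        by auto
      have "\<forall>\<^sub>F n in sequentially. norm ((\<Sum>i<n. s (a i) (e i)) - y) \<le> (\<Sum>k. h k n)"
        using summable_h
      proof eventually_elim
        case (elim n)
        then have "(\<lambda>k. h k n) sums (\<Sum>k. h k n)"
          by (intro summable_sums) (rule summable_norm_cancel)
        then show ?case
          by (rule norm_sums_le[OF sums_diff[OF fin_sums z_sums]]) (simp add: h_def)
      qed
      then have "(\<lambda>n. (\<Sum>i<n. s (a i) (e i)) - y) \<longlonglongrightarrow> 0"
        using lim by (rule Lim_null_comparison)
      then show ?thesis
        by (simp add: sums_def LIM_zero_iff)
    qed
    then have "coeff y = a"
      by (rule coeff_eqI[OF y(1)])
    then show ?thesis
      using bound by (simp add: partial_sums_le_def)
  qed
  moreover have "partial_sums_le (M * norm (0 :: 'a) * 2) 0"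
    using coeff_scaleR[OF zero_mem, of 0] by (simp add: partial_sums_le_def)
  ultimately have "\<forall>y\<in>Y. partial_sums_le (2 * M * norm y) y"
    by (metis mult.commute mult.assoc)
  then show ?thesis ..
qed

theorem unconditional_sequence: "unconditional_sequence e"
proof -
  obtain K where K: "\<And>y. y \<in> Y \<Longrightarrow> partial_sums_le (K * norm y) y"
    using ex_partial_sums_le_mult_norm by blast
  show ?thesis
  proof (rule unconditional_sequence_if_subset_bounded[OF e_neq_0, where K = K])
    fix n :: nat and G and a :: "nat \<Rightarrow> real"
    assume G: "G \<subseteq> {..<n}"
    let ?y = "\<Sum>i<n. s (of_real (a i)) (e i)"
    have "?y \<in> Y"
      using basis subspace_s unfolding unconditional_basis_def
      by (intro subspace_sum subspace_scale) auto
    then have "norm (\<Sum>i\<in>G. s (coeff ?y i) (e i)) \<le> K * norm ?y"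
      using K G finite_subset[OF G] by (auto simp: partial_sums_le_def)
    also have "(\<Sum>i\<in>G. s (coeff ?y i) (e i)) = (\<Sum>i\<in>G. a i *\<^sub>R e i)"
      unfolding coeff_finite_sum by (rule sum.cong) (use G in \<open>auto simp: s_of_real\<close>)
    finally show "norm (\<Sum>i\<in>G. a i *\<^sub>R e i) \<le> K * norm (\<Sum>i<n. a i *\<^sub>R e i)"
      by (simp add: s_of_real)
  qed
qed

end

section \<open>Separated sequences from lattices and bases\<close>

lemma linear_if_scalars_linear:
  assumes "Vector_Spaces.linear s1 s2 T"
    and "\<And>\<rho> x. s1 (of_real \<rho>) x = \<rho> *\<^sub>R x" "\<And>\<rho> x. s2 (of_real \<rho>) x = \<rho> *\<^sub>R x"
  shows "linear T"
proof -
  interpret T: Vector_Spaces.linear s1 s2 T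
    by (rule assms(1))
  show ?thesis
    using T.scale[of "of_real _"] by (intro linearI) (simp_all add: T.add assms(2,3))
qed

lemma infinite_dim_domain:
  assumes "Vector_Spaces.linear s1 s2 T" "homeomorphism UNIV Y T S" "infinite_dim_subspace s2 Y"
  shows "\<nexists>B. finite B \<and> module.span s1 B = UNIV"
proof
  interpret T: Vector_Spaces.linear s1 s2 T
    by (rule assms(1))
  assume "\<exists>B. finite B \<and> module.span s1 B = UNIV"
  then obtain B where B: "finite B" "T.vs1.span B = UNIV"
    by blast
  have "Y \<subseteq> T.vs2.span (T ` B)"
    using assms(2) B(2) by (simp add: T.span_image homeomorphism_def)
  with B(1) assms(3) show False
    unfolding infinite_dim_subspace_def by blast
qed

lemma sphere_separates_if_lattice_embeds:
  fixes T :: "'b::banach_lattice \<Rightarrow> 'a::real_normed_vector"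
  assumes "\<nexists>B :: 'b set. finite B \<and> span B = UNIV"
    and "linear T" "0 < m" "\<And>x. m * norm x \<le> norm (T x)" "\<And>x. norm (T x) \<le> M * norm x"
  shows "sphere_separates TYPE('a)"
proof -
  obtain d :: "nat \<Rightarrow> 'b" where "\<And>n. 0 < d n" "\<And>n k. n \<noteq> k \<Longrightarrow> inf (d n) (d k) = 0"
    using ex_disjoint_sequence[OF assms(1)] by blast
  then have "unconditional_sequence d"
    by (rule unconditional_sequence_if_disjoint)
  then have "unconditional_sequence (\<lambda>n. T (d n))"
    by (rule unconditional_sequence_image[OF _ assms(2-5)])
  then show ?thesis
    by (rule sphere_separates_if_unconditional_sequence)
qed

text \<open>For a real element the modulus is the supremum of all cos \<theta> x, which is |x|: the
  angles 0 and pi contribute x and - x.\<close>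

lemma complexification_norm:
  assumes "complexification \<iota>"
  shows "norm (\<iota> x) = norm x"
proof -
  have \<iota>: "linear \<iota>"
    using assms by (simp add: complexification_def)
  have "\<i> *\<^sub>C \<iota> 0 = 0"
    using norm_scaleC[of \<i> "\<iota> 0"] linear_0[OF \<iota>] by simp
  then obtain m where m: "isLub UNIV (range (\<lambda>\<theta>. cos \<theta> *\<^sub>R x + sin \<theta> *\<^sub>R 0)) m" "norm (\<iota> x) = norm m"
    using assms unfolding complexification_def by (metis add.right_neutral)
  have "m = \<bar>x\<bar>"
  proof (rule antisym)
    have "cos \<theta> *\<^sub>R x \<le> \<bar>x\<bar>" for \<theta>
    proof -
      have "cos \<theta> *\<^sub>R x \<le> \<bar>cos \<theta>\<bar> *\<^sub>R \<bar>x\<bar>"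
      proof (cases "0 \<le> cos \<theta>")
        case True
        then show ?thesis
          by (simp add: abs_ge_self scaleR_left_mono)
      next
        case False
        then have "(- cos \<theta>) *\<^sub>R (- x) \<le> (- cos \<theta>) *\<^sub>R \<bar>x\<bar>"
          by (intro scaleR_left_mono) (auto simp: abs_ge_minus_self)
        then show ?thesis
          using False by simp
      qed
      also have "\<dots> \<le> 1 *\<^sub>R \<bar>x\<bar>"
        by (intro scaleR_right_mono) auto
      finally show ?thesis
        by simp
    qed
    then show "m \<le> \<bar>x\<bar>"
      using m(1) unfolding isLub_def leastP_def isUb_def setle_def setge_def by auto
    have ub: "cos \<theta> *\<^sub>R x \<le> m" for \<theta>
      using m(1) unfolding isLub_def leastP_def isUb_def setle_def by auto
    show "\<bar>x\<bar> \<le> m"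
      using ub[of 0] ub[of pi] by (simp add: abs_le_iff)
  qed
  then have "norm m \<le> norm x" "norm x \<le> norm m"
    by (auto intro: norm_mono_abs)
  with m(2) show ?thesis
    by simp
qed

text \<open>The image under \<iota> of a finite real spanning set would span the complexification
  over the complex scalars.\<close>

lemma complexification_infinite_dim:
  fixes \<iota> :: "'e::banach_lattice \<Rightarrow> 'd::complex_banach"
  assumes "complexification \<iota>" "\<nexists>B :: 'd set. finite B \<and> module.span scaleC B = UNIV"
  shows "\<nexists>B :: 'e set. finite B \<and> span B = UNIV"
proof
  interpret C: vector_space "scaleC :: complex \<Rightarrow> 'd \<Rightarrow> 'd"
    by (rule vector_space_scaleC)
  have \<iota>: "linear \<iota>"
    using assms by (simp add: complexification_def)
  assume "\<exists>B :: 'e set. finite B \<and> span B = UNIV"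
  then obtain B :: "'e set" where B: "finite B" "span B = UNIV"
    by blast
  have in_span: "\<iota> x \<in> C.span (\<iota> ` B)" for x
  proof -
    have "x \<in> span B"
      using B(2) by simp
    then show ?thesis
    proof (induction rule: span_induct_alt)
      case base
      show ?case
        by (simp add: linear_0[OF \<iota>] C.span_zero)
    next
      case (step r x y)
      have "\<iota> x \<in> C.span (\<iota> ` B)"
        using step(1) by (intro C.span_base) simp
      then have "r *\<^sub>R \<iota> x \<in> C.span (\<iota> ` B)"
        unfolding scaleC_of_real[symmetric] by (rule C.span_scale)
      with step show ?case
        by (simp add: linear_add[OF \<iota>] linear_scale[OF \<iota>] C.span_add)
    qed
  qed
  have "z \<in> C.span (\<iota> ` B)" for z
  proof -
    obtain x y where "z = \<iota> x + \<i> *\<^sub>C \<iota> y"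
      using assms(1) unfolding complexification_def by blast
    then show ?thesis
      using in_span by (auto intro: C.span_add C.span_scale)
  qed
  with B(1) assms(2) show False
    by blast
qed

text \<open>Separation involves only the norm, so the complex half is proved with real scalars: T
  \<circ> \<iota> embeds the real part of a complex lattice, and a complex basis is used with real
  coefficients. For bases, \<open>closed Y\<close> supplies the completeness behind Baire's
  theorem.\<close>

theorem theoremB:
  shows
    "((\<exists>Y :: 'a::banach set. infinite_dim_subspace scaleR Y \<and>
        ((\<exists>T :: 'b::banach_lattice \<Rightarrow> 'a. isomorphism_onto scaleR scaleR T Y) \<or>
         (closed Y \<and> (\<exists>e. unconditional_basis scaleR e Y))))
      \<longrightarrow> (\<exists>\<epsilon>>0. \<exists>x :: nat \<Rightarrow> 'a. range x \<subseteq> sphere 0 1 \<and> symmetrically_separated (1 + \<epsilon>) x))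
    \<and>
     ((\<exists>Y :: 'c::complex_banach set. infinite_dim_subspace scaleC Y \<and>
        ((\<exists>(\<iota> :: 'e::banach_lattice \<Rightarrow> 'd::complex_banach) (T :: 'd \<Rightarrow> 'c).
            complexification \<iota> \<and> isomorphism_onto scaleC scaleC T Y) \<or>
         (closed Y \<and> (\<exists>e. unconditional_basis scaleC e Y))))
      \<longrightarrow> (\<exists>\<epsilon>>0. \<exists>x :: nat \<Rightarrow> 'c. range x \<subseteq> sphere 0 1 \<and> symmetrically_separated (1 + \<epsilon>) x))"
  unfolding sphere_separates_def[symmetric, of "TYPE('a)"] sphere_separates_def[symmetric, of "TYPE('c)"]
proof (intro conjI impI; elim exE conjE disjE)
  fix Y :: "'a set" and T :: "'b \<Rightarrow> 'a"
  assume Y: "infinite_dim_subspace scaleR Y" and "isomorphism_onto scaleR scaleR T Y"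
  then obtain S where T: "Vector_Spaces.linear scaleR scaleR T" "homeomorphism UNIV Y T S"
    by (auto simp: isomorphism_onto_def)
  have "linear T"
    by (rule linear_if_scalars_linear[OF T(1)]) simp_all
  moreover obtain m M where "0 < m" "\<And>x. m * norm x \<le> norm (T x)" "\<And>x. norm (T x) \<le> M * norm x"
    by (rule linear_homeomorphism_bounds[OF \<open>linear T\<close> T(2)]) blast
  moreover have "\<nexists>B :: 'b set. finite B \<and> span B = UNIV"
    using infinite_dim_domain[OF T Y] unfolding span_raw_def .
  ultimately show "sphere_separates TYPE('a)"
    by (rule sphere_separates_if_lattice_embeds[rotated])
next
  fix Y :: "'a set" and e
  assume "infinite_dim_subspace scaleR Y" "closed Y" "unconditional_basis scaleR e Y"
  then interpret closed_unconditional_basis scaleR e Y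
    by unfold_locales (auto simp: infinite_dim_subspace_def scaleR_add_right scaleR_add_left)
  show "sphere_separates TYPE('a)"
    using unconditional_sequence by (rule sphere_separates_if_unconditional_sequence)
next
  fix Y :: "'c set" and \<iota> :: "'e \<Rightarrow> 'd" and T :: "'d \<Rightarrow> 'c"
  assume Y: "infinite_dim_subspace scaleC Y" and \<iota>: "complexification \<iota>"
    and "isomorphism_onto scaleC scaleC T Y"
  then obtain S where T: "Vector_Spaces.linear scaleC scaleC T" "homeomorphism UNIV Y T S"
    by (auto simp: isomorphism_onto_def)
  have "linear T"
    by (rule linear_if_scalars_linear[OF T(1)]) (simp_all add: scaleC_of_real)
  then obtain m M where "0 < m" "\<And>x. m * norm x \<le> norm (T x)" "\<And>x. norm (T x) \<le> M * norm x"
    by (rule linear_homeomorphism_bounds[OF _ T(2)]) blast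
  moreover have "linear (T \<circ> \<iota>)"
    using \<iota> \<open>linear T\<close> by (intro linear_compose) (simp_all add: complexification_def)
  moreover have "\<nexists>B :: 'e set. finite B \<and> span B = UNIV"
    by (rule complexification_infinite_dim[OF \<iota> infinite_dim_domain[OF T Y]])
  ultimately show "sphere_separates TYPE('c)"
    by (intro sphere_separates_if_lattice_embeds[of "T \<circ> \<iota>" m M])
      (simp_all add: complexification_norm[OF \<iota>, symmetric])
next
  fix Y :: "'c set" and e
  assume "infinite_dim_subspace scaleC Y" "closed Y" "unconditional_basis scaleC e Y"
  then interpret closed_unconditional_basis scaleC e Y
    by (intro closed_unconditional_basis.intro)
      (auto simp: infinite_dim_subspace_def vector_space_scaleC norm_scaleC scaleC_of_real)
  show "sphere_separates TYPE('c)"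
    using unconditional_sequence by (rule sphere_separates_if_unconditional_sequence)
qed

end
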